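(* Let $X$ be a metric space whose completion $\tilde X$ is not locally compact. (1) If the local density of $\tilde X$ is not realized, then $$\mathrm{PK}(X)\approx \mathrm{Fin}(\mathrm{d}(X))\times \mathrm{Bdd}\bigl(\mathrm{Fin}(\mathrm{ld}(\tilde X))^{\mathbb N}\bigr).$$ (2) If the local density of $\tilde X$ is realized, or the cardinal number $\mathrm{ld}(\tilde X)$ has uncountable cofinality, then $$\mathrm{PK}(X)\approx \mathrm{Fin}(\mathrm{d}(X))\times \mathrm{Fin}(\mathrm{ld}(\tilde X))^{\mathbb N}.$$
   Context: Precompact means totally bounded. $\mathrm{PK}(X)$ is the family of precompact subsets of $X$, partially ordered by inclusion. $\mathrm{d}(X)$ is the minimal cardinality of a dense subset of $X$. For a point $x$ of a topological space $Y$, the local density $\mathrm{ld}(x)$ is the minimal density of a neighborhood of $x$; the local density $\mathrm{ld}(Y)$ of $Y$ is the supremum of $\mathrm{ld}(x)$ over the points $x\in Y$; it is realized if there is $x\in Y$ with $\mathrm{ld}(x)=\mathrm{ld}(Y)$. For a set $S$, $\mathrm{Fin}(S)$ is the set of finite subsets of $S$, ordered by inclusion; $\mathrm{Fin}(S)^{\mathbb N}$ is the set of functions $f\colon\mathbb N\to\mathrm{Fin}(S)$, ordered by $f\le g$ iff $f(n)\subseteq g(n)$ for all $n$. For an infinite cardinal $\kappa$, $\mathrm{Bdd}(\mathrm{Fin}(\kappa)^{\mathbb N}):=\bigcup_{\alpha<\kappa}\mathrm{Fin}(\alpha)^{\mathbb N}$ (union over ordinals $\alpha<\kappa$), with the order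 inherited from $\mathrm{Fin}(\kappa)^{\mathbb N}$. Products of partially ordered sets carry the coordinatewise order. For partially ordered sets $P,Q$, write $P\preceq Q$ if there is a monotone (order-preserving) map $\psi\colon P\to Q$ whose image is cofinal in $Q$ (every $q\in Q$ satisfies $q\le\psi(p)$ for some $p\in P$). $P\approx Q$ (cofinal equivalence) means $P\preceq Q$ and $Q\preceq P$. *)

theory Defs
  imports "HOL-Analysis.Analysis"
begin

unbundle cardinal_syntax

section \<open>Cofinal equivalence of partially ordered sets\<close>

text \<open>A partially ordered set is a subset of a type of class \<^class>\<open>order\<close>. The library instances
  order sets by inclusion, functions pointwise and pairs coordinatewise.\<close>

definition cof_maps_onto :: "'a::order set \<Rightarrow> 'b::order set \<Rightarrow> bool" where
  "cof_maps_onto P Q \<longleftrightarrow>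
     (\<exists>\<psi>. \<psi> \<in> P \<rightarrow> Q \<and> mono_on P \<psi> \<and> (\<forall>q\<in>Q. \<exists>p\<in>P. q \<le> \<psi> p))"

definition cof_equiv :: "'a::order set \<Rightarrow> 'b::order set \<Rightarrow> bool" where
  "cof_equiv P Q \<longleftrightarrow> cof_maps_onto P Q \<and> cof_maps_onto Q P"

section \<open>Cardinals\<close>

text \<open>Cardinal numbers are cardinal orders (\<^const>\<open>Card_order\<close>), compared up to \<open>=o\<close>. Thus
  \<^term>\<open>Field \<kappa>\<close> is a set of cardinality \<open>\<kappa>\<close>, and the ordinals below \<open>\<kappa>\<close> are the initial
  segments \<^term>\<open>underS \<kappa> a\<close> with \<^prop>\<open>a \<in> Field \<kappa>\<close>.\<close>

definition least_card :: "'a rel set \<Rightarrow> 'a rel" where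
  "least_card R = (SOME r. r \<in> R \<and> (\<forall>r'\<in>R. r \<le>o r'))"

text \<open>The supremum of a family of cardinals of sets of elements of type \<^typ>\<open>'a\<close>; it is attained
  in that type because \<^term>\<open>|UNIV :: 'a set|\<close> is an upper bound.\<close>

definition card_Sup :: "'a rel set \<Rightarrow> 'a rel" where
  "card_Sup R = least_card {r. Card_order r \<and> (\<forall>s\<in>R. s \<le>o r)}"

definition uncountable_cofinality :: "'a rel \<Rightarrow> bool" where
  "uncountable_cofinality \<kappa> \<longleftrightarrow> (\<forall>A. A \<subseteq> Field \<kappa> \<and> cofinal A \<kappa> \<longrightarrow> uncountable A)"

lemma least_card:
  assumes "R \<noteq> {}" "\<And>r. r \<in> R \<Longrightarrow> Card_order r"
  shows "least_card R \<in> R" and "r \<in> R \<Longrightarrow> least_card R \<le>o r"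
proof -
  have "\<exists>r. r \<in> R \<and> (\<forall>r'\<in>R. r \<le>o r')"
    using exists_minim_Card_order[of R] assms by blast
  from someI_ex[OF this] show "least_card R \<in> R" and "r \<in> R \<Longrightarrow> least_card R \<le>o r"
    unfolding least_card_def by blast+
qed

lemma card_Sup:
  fixes R :: "'a rel set"
  assumes "\<And>r. r \<in> R \<Longrightarrow> Card_order r"
  shows "Card_order (card_Sup R)" and "s \<in> R \<Longrightarrow> s \<le>o card_Sup R"
    and "Card_order r \<Longrightarrow> (\<And>s. s \<in> R \<Longrightarrow> s \<le>o r) \<Longrightarrow> card_Sup R \<le>o (r :: 'a rel)"
proof -
  let ?U = "{r :: 'a rel. Card_order r \<and> (\<forall>s\<in>R. s \<le>o r)}"
  have "s \<le>o |UNIV :: 'a set|" if "s \<in> R" for s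
    using assms[OF that] card_of_Field_ordIso card_of_mono1[of "Field s" UNIV]
      ordIso_ordLeq_trans ordIso_symmetric by blast
  then have "|UNIV :: 'a set| \<in> ?U"
    using card_of_Card_order by blast
  then have ne: "?U \<noteq> {}" by blast
  have mem: "card_Sup R \<in> ?U"
    unfolding card_Sup_def by (rule least_card(1)[OF ne]) simp
  then show "Card_order (card_Sup R)" and "s \<in> R \<Longrightarrow> s \<le>o card_Sup R" by auto
  show "card_Sup R \<le>o r" if "Card_order r" "\<And>s. s \<in> R \<Longrightarrow> s \<le>o r"
    unfolding card_Sup_def by (rule least_card(2)[OF ne]) (use that in auto)
qed

section \<open>Density and local density\<close>

definition dense_in :: "'a topology \<Rightarrow> 'a set \<Rightarrow> bool" where
  "dense_in T A \<longleftrightarrow> A \<subseteq> topspace T \<and> T closure_of A = topspace T"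

definition density_card :: "'a topology \<Rightarrow> 'a rel" where
  "density_card T = least_card {|A| | A. dense_in T A}"

definition neighborhood_of :: "'a topology \<Rightarrow> 'a \<Rightarrow> 'a set \<Rightarrow> bool" where
  "neighborhood_of T x U \<longleftrightarrow> U \<subseteq> topspace T \<and> (\<exists>V. openin T V \<and> x \<in> V \<and> V \<subseteq> U)"

definition local_density_at :: "'a topology \<Rightarrow> 'a \<Rightarrow> 'a rel" where
  "local_density_at T x = least_card {density_card (subtopology T U) | U. neighborhood_of T x U}"

definition local_density :: "'a topology \<Rightarrow> 'a rel" where
  "local_density T = card_Sup (local_density_at T ` topspace T)"

definition local_density_realized :: "'a topology \<Rightarrow> bool" where
  "local_density_realized T \<longleftrightarrow> (\<exists>x\<in>topspace T. local_density_at T x =o local_density T)"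

lemma density_card:
  shows "\<exists>A. dense_in T A \<and> density_card T = |A|" and "dense_in T A \<Longrightarrow> density_card T \<le>o |A|"
proof -
  let ?R = "{|A| | A. dense_in T A}"
  have "dense_in T (topspace T)"
    by (simp add: dense_in_def closure_of_topspace)
  then have ne: "?R \<noteq> {}" by blast
  have co: "\<And>r. r \<in> ?R \<Longrightarrow> Card_order r" by (auto simp: card_of_Card_order)
  show "\<exists>A. dense_in T A \<and> density_card T = |A|"
    using least_card(1)[OF ne co] unfolding density_card_def by blast
  show "dense_in T A \<Longrightarrow> density_card T \<le>o |A|"
    using least_card(2)[OF ne co] unfolding density_card_def by blast
qed

lemma Card_order_density_card: "Card_order (density_card T)"
  using density_card(1)[of T] card_of_Card_order by metis

lemma local_density_at:
  assumes "x \<in> topspace T"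
  shows "\<exists>U. neighborhood_of T x U \<and> local_density_at T x = density_card (subtopology T U)"
    and "neighborhood_of T x U \<Longrightarrow> local_density_at T x \<le>o density_card (subtopology T U)"
proof -
  let ?R = "{density_card (subtopology T U) | U. neighborhood_of T x U}"
  have "neighborhood_of T x (topspace T)"
    using assms unfolding neighborhood_of_def by blast
  then have ne: "?R \<noteq> {}" by blast
  have co: "\<And>r. r \<in> ?R \<Longrightarrow> Card_order r" by (auto simp: Card_order_density_card)
  show "\<exists>U. neighborhood_of T x U \<and> local_density_at T x = density_card (subtopology T U)"
    using least_card(1)[OF ne co] unfolding local_density_at_def by blast
  show "neighborhood_of T x U \<Longrightarrow> local_density_at T x \<le>o density_card (subtopology T U)"
    using least_card(2)[OF ne co] unfolding local_density_at_def by blast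
qed

section \<open>The partially ordered sets\<close>

definition PK :: "'a set \<Rightarrow> ('a \<Rightarrow> 'a \<Rightarrow> real) \<Rightarrow> 'a set set" where
  "PK M d = {K. K \<subseteq> M \<and> Metric_space.mtotally_bounded M d K}"

text \<open>The finite subsets of \<open>S\<close> are \<^term>\<open>Fpow S\<close>.\<close>

definition Fin_seq :: "'a set \<Rightarrow> (nat \<Rightarrow> 'a set) set" where
  "Fin_seq S = (UNIV \<rightarrow> Fpow S)"

definition Bdd_Fin_seq :: "'a rel \<Rightarrow> (nat \<Rightarrow> 'a set) set" where
  "Bdd_Fin_seq \<kappa> = (\<Union>a\<in>Field \<kappa>. Fin_seq (underS \<kappa> a))"

section \<open>Completions\<close>

text \<open>\<open>(N, e)\<close> is a completion of \<open>(M, d)\<close> via the isometric embedding \<open>\<iota>\<close>; completions are unique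
  up to isometry.\<close>

definition is_completion ::
  "'a set \<Rightarrow> ('a \<Rightarrow> 'a \<Rightarrow> real) \<Rightarrow> 'b set \<Rightarrow> ('b \<Rightarrow> 'b \<Rightarrow> real) \<Rightarrow> ('a \<Rightarrow> 'b) \<Rightarrow> bool" where
  "is_completion M d N e \<iota> \<longleftrightarrow>
     Metric_space N e \<and> Metric_space.mcomplete N e \<and> \<iota> \<in> M \<rightarrow> N \<and>
     (\<forall>x\<in>M. \<forall>y\<in>M. e (\<iota> x) (\<iota> y) = d x y) \<and>
     dense_in (Metric_space.mtopology N e) (\<iota> ` M)"

end

theory Submission
  imports Defs "HOL-Library.Countable_Set_Type"
begin

text \<open>
  Write \<open>N\<close> for the completion, \<open>X\<close> for the image of the given space in \<open>N\<close>, and \<open>\<lambda>\<close> for the local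
  density of \<open>N\<close>. A sequence of finite sets belongs to \<open>Bdd_Fin_seq \<lambda>\<close>, respectively to
  \<open>Fin_seq (Field \<lambda>)\<close>, iff it is a sequence of finite subsets of one member of a directed family
  \<open>\<S>\<close>: the family of proper initial segments of \<open>\<lambda>\<close>, respectively \<open>{Field \<lambda>}\<close>. Both parts thus
  concern \<open>Fin(d(X)) \<times> (\<Union>S\<in>\<S>. Fin_seq S)\<close>, and both are instances of \<open>precompacts_cof_equiv\<close>.

  From codes to precompact sets. The balls of radius \<open>1/(n+1)\<close> around a dense set of size \<open>d(X)\<close> form a
  base, and those that lie in the closure of a set indexed by a member of \<open>\<S>\<close> cover \<open>N\<close>. Since a precompact
  set has compact closure in \<open>N\<close>, it lies in finitely many of them, and then, for every \<open>n\<close>, within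
  \<open>1/(n+1)\<close> of finitely many members of these indexed sets. The finitely many balls are an element of
  \<open>Fin(d(X))\<close>, and the indices of the points chosen for the various \<open>n\<close> form the sequence.

  From precompact sets to codes. If \<open>B\<close> is a ball, \<open>B \<inter> X\<close> is not precompact, and every dense subset of
  \<open>B \<inter> X\<close> has at least \<open>|S|\<close> elements, then a precompact set can be mapped monotonically to a finite subset of \<open>S\<close>
  so that finite subsets of \<open>B \<inter> X\<close> already have cofinal images (\<open>finite_coding\<close>). Applied to \<open>X\<close>
  itself, this gives the factor \<open>Fin(d(X))\<close>. Applied to the balls of radius \<open>1/(n+1)\<close> around one
  point \<open>x\<close>, it gives all of \<open>Fin_seq S\<close>, because finite subsets of these balls, one for each \<open>n\<close>,
  together form a sequence that converges to \<open>x\<close>. If the local density is realized, one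
  point \<open>x\<close> suffices, with \<open>S = Field \<lambda>\<close>. Otherwise the local densities of points are unbounded below
  the cardinal \<open>\<lambda>\<close>, and the codes belonging to many points are combined. A precompact set is near only
  finitely many points of a uniformly separated set \<open>E\<close>, so that the union of their codes is again
  finite at each \<open>n\<close>, and bounded. A separated \<open>E\<close> with unbounded local densities is provided by
  \<open>uniformly_locally_bounded_unbounded_set\<close> (completeness) and \<open>separated_unbounded_set\<close> (a
  transfinite recursion).

  If \<open>\<lambda>\<close> has uncountable cofinality, then the countable union of the entries of a sequence in
  \<open>Fin_seq (Field \<lambda>)\<close> is bounded, and the two sets of sequences coincide.
\<close>

section \<open>Cofinal maps\<close>

lemma cof_maps_ontoI:
  assumes "\<And>p. p \<in> P \<Longrightarrow> \<psi> p \<in> Q" "\<And>p p'. p \<in> P \<Longrightarrow> p' \<in> P \<Longrightarrow> p \<le> p' \<Longrightarrow> \<psi> p \<le> \<psi> p'"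
    and "\<And>q. q \<in> Q \<Longrightarrow> \<exists>p\<in>P. q \<le> \<psi> p"
  shows "cof_maps_onto P Q"
  unfolding cof_maps_onto_def using assms by (intro exI[of _ \<psi>]) (auto intro!: mono_onI)

lemma cof_maps_onto_trans:
  assumes "cof_maps_onto P Q" "cof_maps_onto Q R"
  shows "cof_maps_onto P R"
proof -
  obtain \<phi> where \<phi>: "\<phi> \<in> P \<rightarrow> Q" "mono_on P \<phi>" "\<And>q. q \<in> Q \<Longrightarrow> \<exists>p\<in>P. q \<le> \<phi> p"
    using assms(1) unfolding cof_maps_onto_def by blast
  obtain \<psi> where \<psi>: "\<psi> \<in> Q \<rightarrow> R" "mono_on Q \<psi>" "\<And>r. r \<in> R \<Longrightarrow> \<exists>q\<in>Q. r \<le> \<psi> q"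
    using assms(2) unfolding cof_maps_onto_def by blast
  show ?thesis
  proof (rule cof_maps_ontoI[where \<psi> = "\<psi> \<circ> \<phi>"])
    show "(\<psi> \<circ> \<phi>) p \<in> R" if "p \<in> P" for p
      using \<phi>(1) \<psi>(1) that by auto
    show "(\<psi> \<circ> \<phi>) p \<le> (\<psi> \<circ> \<phi>) p'" if "p \<in> P" "p' \<in> P" "p \<le> p'" for p p'
      using \<phi>(1) mono_onD[OF \<phi>(2) that] mono_onD[OF \<psi>(2)] that by auto
    show "\<exists>p\<in>P. r \<le> (\<psi> \<circ> \<phi>) p" if "r \<in> R" for r
    proof -
      obtain q where q: "q \<in> Q" "r \<le> \<psi> q" using \<psi>(3)[OF \<open>r \<in> R\<close>] by blast
      obtain p where p: "p \<in> P" "q \<le> \<phi> p" using \<phi>(3)[OF q(1)] by blast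
      have "\<psi> q \<le> \<psi> (\<phi> p)"
        using mono_onD[OF \<psi>(2) q(1) _ p(2)] \<phi>(1) p(1) by auto
      then show ?thesis using p(1) q(2) order_trans by force
    qed
  qed
qed

text \<open>A pair \<open>(q, r)\<close> is dominated at a common upper bound of a point that serves \<open>q\<close> and a point that
  serves \<open>r\<close>.\<close>

lemma cof_maps_onto_Times:
  assumes "cof_maps_onto P Q" "cof_maps_onto P R"
    and dir: "\<And>p p'. p \<in> P \<Longrightarrow> p' \<in> P \<Longrightarrow> \<exists>u\<in>P. p \<le> u \<and> p' \<le> u"
  shows "cof_maps_onto P (Q \<times> R)"
proof -
  obtain \<phi> where \<phi>: "\<phi> \<in> P \<rightarrow> Q" "mono_on P \<phi>" "\<And>q. q \<in> Q \<Longrightarrow> \<exists>p\<in>P. q \<le> \<phi> p"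
    using assms(1) unfolding cof_maps_onto_def by blast
  obtain \<psi> where \<psi>: "\<psi> \<in> P \<rightarrow> R" "mono_on P \<psi>" "\<And>r. r \<in> R \<Longrightarrow> \<exists>q\<in>P. r \<le> \<psi> q"
    using assms(2) unfolding cof_maps_onto_def by blast
  show ?thesis
  proof (rule cof_maps_ontoI[where \<psi> = "\<lambda>p. (\<phi> p, \<psi> p)"])
    show "(\<phi> p, \<psi> p) \<in> Q \<times> R" if "p \<in> P" for p
      using \<phi>(1) \<psi>(1) that by auto
    show "(\<phi> p, \<psi> p) \<le> (\<phi> p', \<psi> p')" if "p \<in> P" "p' \<in> P" "p \<le> p'" for p p'
      using mono_onD[OF \<phi>(2) that] mono_onD[OF \<psi>(2) that] by simp
    show "\<exists>p\<in>P. qr \<le> (\<phi> p, \<psi> p)" if "qr \<in> Q \<times> R" for qr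
    proof -
      obtain p p' where p: "p \<in> P" "fst qr \<le> \<phi> p" "p' \<in> P" "snd qr \<le> \<psi> p'"
        using \<phi>(3)[of "fst qr"] \<psi>(3)[of "snd qr"] \<open>qr \<in> Q \<times> R\<close> by (auto simp: mem_Times_iff)
      obtain u where u: "u \<in> P" "p \<le> u" "p' \<le> u" using dir p by blast
      have "fst qr \<le> \<phi> u" "snd qr \<le> \<psi> u"
        using p u mono_onD[OF \<phi>(2)] mono_onD[OF \<psi>(2)] order_trans by blast+
      then show ?thesis using u(1) by (auto simp: less_eq_prod_def)
    qed
  qed
qed

section \<open>Separated sets and total boundedness\<close>

definition separated_by :: "('a \<Rightarrow> 'a \<Rightarrow> real) \<Rightarrow> real \<Rightarrow> 'a set \<Rightarrow> bool" where
  "separated_by d \<epsilon> A \<longleftrightarrow> (\<forall>a\<in>A. \<forall>b\<in>A. a \<noteq> b \<longrightarrow> \<epsilon> \<le> d a b)"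

context Metric_space
begin

lemma maximal_separated:
  assumes "0 < \<epsilon>" "Y \<subseteq> M"
  shows "\<exists>A\<subseteq>Y. separated_by d \<epsilon> A \<and> Y \<subseteq> (\<Union>a\<in>A. mball a \<epsilon>)"
proof -
  let ?\<A> = "{A. A \<subseteq> Y \<and> separated_by d \<epsilon> A}"
  have "\<Union>\<C> \<in> ?\<A>" if "\<C> \<noteq> {}" "subset.chain ?\<A> \<C>" for \<C>
  proof -
    have sub: "\<C> \<subseteq> ?\<A>" and ch: "\<And>A B. A \<in> \<C> \<Longrightarrow> B \<in> \<C> \<Longrightarrow> A \<subseteq> B \<or> B \<subseteq> A"
      using that(2) unfolding subset_chain_def by blast+
    have "\<epsilon> \<le> d a b" if "A \<in> \<C>" "a \<in> A" "B \<in> \<C>" "b \<in> B" "a \<noteq> b" for A B a b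
    proof -
      have "\<exists>C\<in>\<C>. a \<in> C \<and> b \<in> C" using ch[of A B] that by blast
      then show ?thesis using sub that(5) unfolding separated_by_def by blast
    qed
    then show ?thesis using sub unfolding separated_by_def by blast
  qed
  moreover have "{} \<in> ?\<A>" by (simp add: separated_by_def)
  then have "?\<A> \<noteq> {}" by blast
  ultimately have "\<exists>A\<in>?\<A>. \<forall>B\<in>?\<A>. A \<subseteq> B \<longrightarrow> B = A"
    by (intro subset_Zorn_nonempty) auto
  then obtain A where A: "A \<in> ?\<A>" and max: "\<And>B. B \<in> ?\<A> \<Longrightarrow> A \<subseteq> B \<Longrightarrow> B = A"
    by (elim bexE) blast
  have "y \<in> (\<Union>a\<in>A. mball a \<epsilon>)" if "y \<in> Y" for y
  proof (rule ccontr)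
    assume out: "y \<notin> (\<Union>a\<in>A. mball a \<epsilon>)"
    have far: "\<epsilon> \<le> d a y" if "a \<in> A" for a
    proof -
      have "a \<in> M" "y \<in> M" "y \<notin> mball a \<epsilon>"
        using that A \<open>Y \<subseteq> M\<close> \<open>y \<in> Y\<close> out by auto
      then show ?thesis by simp
    qed
    then have "\<epsilon> \<le> d y a" if "a \<in> A" for a
      using that commute[of y a] by simp
    then have "insert y A \<in> ?\<A>"
      using A \<open>y \<in> Y\<close> far unfolding separated_by_def by simp
    then have "y \<in> A" using max[of "insert y A"] by blast
    then show False using far[of y] \<open>y \<in> Y\<close> \<open>Y \<subseteq> M\<close> \<open>0 < \<epsilon>\<close> by auto
  qed
  then show ?thesis using A by blast
qed

text \<open>Distinct points of \<open>A\<close> whose balls meet \<open>K\<close> are served by distinct members of a finite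
  \<open>\<epsilon>/6\<close>-net of \<open>K\<close>.\<close>

lemma finite_separated_near:
  assumes "mtotally_bounded K" "separated_by d \<epsilon> A" "0 < \<epsilon>"
  shows "finite {a\<in>A. K \<inter> mball a (\<epsilon>/3) \<noteq> {}}" (is "finite ?H")
proof -
  obtain F where F: "finite F" "K \<subseteq> (\<Union>x\<in>F. mball x (\<epsilon>/6))"
    using assms(1,3) unfolding mtotally_bounded_def by (metis zero_less_divide_iff zero_less_numeral)
  have "\<exists>c\<in>F. c \<in> M \<and> a \<in> M \<and> d a c < \<epsilon>/2" if "a \<in> ?H" for a
  proof -
    obtain k where k: "k \<in> K" "a \<in> M" "k \<in> M" "d a k < \<epsilon>/3" using \<open>a \<in> ?H\<close> by auto
    then obtain c where c: "c \<in> F" "c \<in> M" "d c k < \<epsilon>/6" using F(2) by auto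
    have "d a c \<le> d a k + d c k" using k c triangle' by blast
    then show ?thesis using k c by auto
  qed
  then obtain c where c: "\<And>a. a \<in> ?H \<Longrightarrow> c a \<in> F \<and> c a \<in> M \<and> a \<in> M \<and> d a (c a) < \<epsilon>/2"
    by metis
  have "inj_on c ?H"
  proof (rule inj_onI, rule ccontr)
    fix a b assume ab: "a \<in> ?H" "b \<in> ?H" "c a = c b" "a \<noteq> b"
    have "d a b \<le> d a (c a) + d b (c b)" using c[OF ab(1)] c[OF ab(2)] ab(3) triangle' by metis
    then have "d a b < \<epsilon>" using c[OF ab(1)] c[OF ab(2)] by linarith
    moreover have "\<epsilon> \<le> d a b" using ab assms(2) unfolding separated_by_def by blast
    ultimately show False by simp
  qed
  moreover have "c ` ?H \<subseteq> F" using c by blast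
  ultimately show ?thesis using F(1) inj_on_finite by blast
qed

lemma mtotally_bounded_by_any_centres:
  assumes "K \<subseteq> M" "\<And>\<epsilon>. 0 < \<epsilon> \<Longrightarrow> \<exists>F. finite F \<and> K \<subseteq> (\<Union>x\<in>F. mball x \<epsilon>)"
  shows "mtotally_bounded K"
  unfolding mtotally_bounded_def
proof (intro allI impI)
  fix \<epsilon> :: real assume "0 < \<epsilon>"
  then obtain F where F: "finite F" "K \<subseteq> (\<Union>x\<in>F. mball x (\<epsilon>/2))" using assms(2)[of "\<epsilon>/2"] by auto
  let ?F = "{x\<in>F. K \<inter> mball x (\<epsilon>/2) \<noteq> {}}"
  define p where "p x = (SOME k. k \<in> K \<inter> mball x (\<epsilon>/2))" for x
  have p: "p x \<in> K \<inter> mball x (\<epsilon>/2)" if "x \<in> ?F" for x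
    unfolding p_def by (rule someI_ex) (use that in blast)
  have "k \<in> (\<Union>x\<in>p ` ?F. mball x \<epsilon>)" if "k \<in> K" for k
  proof -
    obtain x where x: "x \<in> F" "k \<in> mball x (\<epsilon>/2)" using F(2) \<open>k \<in> K\<close> by blast
    then have xF: "x \<in> ?F" using \<open>k \<in> K\<close> by blast
    have "d (p x) k \<le> d x (p x) + d x k" using triangle'' p[OF xF] x(2) by auto
    then have "k \<in> mball (p x) \<epsilon>" using p[OF xF] x(2) by auto
    then show ?thesis using xF by blast
  qed
  moreover have "p ` ?F \<subseteq> K" using p by blast
  ultimately show "\<exists>F. finite F \<and> F \<subseteq> K \<and> K \<subseteq> (\<Union>x\<in>F. mball x \<epsilon>)"
    using F(1) by (intro exI[of _ "p ` ?F"]) auto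
qed

text \<open>Index \<open>S\<close> injectively by a union of \<open>1/(k+1)\<close>-separated nets \<open>A k\<close> of \<open>Y\<close>, which is
  dense. At each scale \<open>k\<close> a precompact \<open>K\<close> meets only finitely many of the balls around
  \<open>A k\<close>, but it may meet some at every scale, so the code may use only the scales up to a bound
  \<open>m K\<close> that depends monotonically on \<open>K\<close>. Since \<open>Y\<close> is not precompact, \<open>A k0\<close> is infinite for some
  \<open>k0\<close>; the number of balls around \<open>A k0\<close> that \<open>K\<close> meets is such a bound, and it becomes arbitrarily
  large when finitely many points of \<open>A k0\<close> are added to \<open>K\<close>.\<close>

lemma finite_coding:
  fixes S :: "'b set"
  assumes "Y \<subseteq> M" "\<not> mtotally_bounded Y"
    and dens: "\<And>D. D \<subseteq> Y \<Longrightarrow> Y \<subseteq> mtopology closure_of D \<Longrightarrow> |S| \<le>o |D|"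
  shows "\<exists>\<phi>. (\<forall>K. mtotally_bounded K \<longrightarrow> \<phi> K \<in> Fpow S) \<and>
             (\<forall>K L. mtotally_bounded L \<longrightarrow> K \<subseteq> L \<longrightarrow> \<phi> K \<subseteq> \<phi> L) \<and>
             (\<forall>G\<in>Fpow S. \<exists>L\<subseteq>Y. finite L \<and> G \<subseteq> \<phi> L)"
proof -
  define \<epsilon> where "\<epsilon> k = 1 / real (Suc k)" for k
  have \<epsilon>: "0 < \<epsilon> k" for k by (simp add: \<epsilon>_def)
  have "\<forall>k. \<exists>A\<subseteq>Y. separated_by d (\<epsilon> k) A \<and> Y \<subseteq> (\<Union>a\<in>A. mball a (\<epsilon> k))"
    using maximal_separated[OF \<epsilon> \<open>Y \<subseteq> M\<close>] by blast
  then obtain A where A: "\<And>k. A k \<subseteq> Y" "\<And>k. separated_by d (\<epsilon> k) (A k)"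
      "\<And>k. Y \<subseteq> (\<Union>a\<in>A k. mball a (\<epsilon> k))"
    by metis
  have small: "\<exists>k. \<epsilon> k < r" if "0 < r" for r
    unfolding \<epsilon>_def using reals_Archimedean[OF that] by (auto simp: inverse_eq_divide)
  obtain k0 where k0: "infinite (A k0)"
  proof (rule ccontr)
    assume "\<not> thesis"
    then have fin: "finite (A k)" for k using that by blast
    have "mtotally_bounded Y"
    proof (rule mtotally_bounded_by_any_centres[OF \<open>Y \<subseteq> M\<close>])
      fix r :: real assume "0 < r"
      then obtain k where "\<epsilon> k < r" using small by blast
      then have "(\<Union>a\<in>A k. mball a (\<epsilon> k)) \<subseteq> (\<Union>a\<in>A k. mball a r)"
        by (intro UN_mono order_refl mball_subset_concentric) simp
      then show "\<exists>F. finite F \<and> Y \<subseteq> (\<Union>x\<in>F. mball x r)"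
        using fin[of k] order_trans[OF A(3)[of k]] by (intro exI[of _ "A k"]) simp
    qed
    with assms(2) show False by blast
  qed
  define D where "D = (\<Union>k. A k)"
  have "Y \<subseteq> mtopology closure_of D"
  proof
    fix y assume "y \<in> Y"
    have "\<exists>x\<in>D. x \<in> mball y r" if "0 < r" for r
    proof -
      obtain k where k: "\<epsilon> k < r" using small[OF \<open>0 < r\<close>] by blast
      obtain a where a: "a \<in> A k" "y \<in> mball a (\<epsilon> k)" using A(3)[of k] \<open>y \<in> Y\<close> by blast
      then have "a \<in> mball y r" using k by (auto simp: commute)
      then show ?thesis using a(1) unfolding D_def by blast
    qed
    then show "y \<in> mtopology closure_of D" using \<open>y \<in> Y\<close> \<open>Y \<subseteq> M\<close> by (auto simp: metric_closure_of)
  qed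
  moreover have DY: "D \<subseteq> Y" using A(1) unfolding D_def by blast
  ultimately obtain h where h: "inj_on h S" "h ` S \<subseteq> D"
    using dens[of D] card_of_ordLeq[of S D] by blast
  define hit where "hit K k a \<longleftrightarrow> a \<in> A k \<and> K \<inter> mball a (\<epsilon> k / 3) \<noteq> {}" for K k a
  define m where "m K = card {a. hit K k0 a}" for K
  define \<phi> where "\<phi> K = {s\<in>S. \<exists>k\<le>m K. hit K k (h s)}" for K
  have fin: "finite {a. hit K k a}" if "mtotally_bounded K" for K k
    using finite_separated_near[OF that A(2) \<epsilon>] unfolding hit_def by simp
  have hit_mono: "hit K k a \<Longrightarrow> K \<subseteq> L \<Longrightarrow> hit L k a" for K L k a
    unfolding hit_def by blast
  have self: "hit L k a" if "a \<in> A k" "a \<in> L" for L k a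
  proof -
    have "a \<in> mball a (\<epsilon> k / 3)" using \<epsilon> that A(1)[of k] \<open>Y \<subseteq> M\<close> by auto
    then show ?thesis using that unfolding hit_def by blast
  qed
  show ?thesis
  proof (intro exI[of _ \<phi>] conjI allI impI ballI)
    fix K assume K: "mtotally_bounded K"
    have "h ` \<phi> K \<subseteq> (\<Union>k\<le>m K. {a. hit K k a})" unfolding \<phi>_def by blast
    moreover have "finite (\<Union>k\<le>m K. {a. hit K k a})" using fin[OF K] by simp
    ultimately have "finite (h ` \<phi> K)" by (rule finite_subset)
    moreover have "inj_on h (\<phi> K)" using h(1) by (rule inj_on_subset) (auto simp: \<phi>_def)
    ultimately show "\<phi> K \<in> Fpow S" unfolding Fpow_def by (auto dest: finite_imageD simp: \<phi>_def)
  next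
    fix K L assume L: "mtotally_bounded L" and "K \<subseteq> L"
    have "m K \<le> m L" unfolding m_def
      by (rule card_mono[OF fin[OF L]]) (use hit_mono[OF _ \<open>K \<subseteq> L\<close>] in blast)
    then show "\<phi> K \<subseteq> \<phi> L"
      unfolding \<phi>_def using hit_mono[OF _ \<open>K \<subseteq> L\<close>] by (auto intro: order_trans)
  next
    fix G assume G: "G \<in> Fpow S"
    have "\<forall>s\<in>G. \<exists>k. h s \<in> A k" using G h(2) unfolding D_def Fpow_def by blast
    then obtain k where k: "\<And>s. s \<in> G \<Longrightarrow> h s \<in> A (k s)" by metis
    have finG: "finite G" "G \<subseteq> S" using G unfolding Fpow_def by auto
    \<comment> \<open>The points of \<open>C\<close> only serve to raise \<open>m\<close> above all scales \<open>k s\<close>.\<close>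
    obtain C where C: "C \<subseteq> A k0" "finite C" "card C = Max (insert 0 (k ` G))"
      using infinite_arbitrarily_large[OF k0] by blast
    let ?L = "h ` G \<union> C"
    have LY: "?L \<subseteq> Y" using h(2) DY finG(2) C(1) A(1) by blast
    have finL: "finite ?L" using finG C by simp
    have "mtotally_bounded ?L"
      by (rule finite_imp_mtotally_bounded[OF finL order_trans[OF LY \<open>Y \<subseteq> M\<close>]])
    then have "card C \<le> m ?L" unfolding m_def
      using self C(1) by (intro card_mono fin) auto
    then have "k s \<le> m ?L" if "s \<in> G" for s
      using C(3) that finG(1) by (metis Max_ge finite_imageI finite_insert imageI insertI2 order_trans)
    moreover have "hit ?L (k s) (h s)" if "s \<in> G" for s
      by (rule self[OF k[OF that]]) (use that in simp)
    ultimately have "s \<in> \<phi> ?L" if "s \<in> G" for s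
      unfolding \<phi>_def using finG(2) that by (intro CollectI conjI exI[of _ "k s"]) auto
    then show "\<exists>L\<subseteq>Y. finite L \<and> G \<subseteq> \<phi> L" using LY finL by (intro exI[of _ ?L]) auto
  qed
qed

end

section \<open>Coding by sequences\<close>

lemma directed_finite_Union:
  assumes "finite F" "\<And>i. i \<in> F \<Longrightarrow> g i \<in> \<S>" "\<S> \<noteq> {}"
    and "\<And>S T. S \<in> \<S> \<Longrightarrow> T \<in> \<S> \<Longrightarrow> \<exists>U\<in>\<S>. S \<union> T \<subseteq> U"
  shows "\<exists>U\<in>\<S>. (\<Union>i\<in>F. g i) \<subseteq> U"
  using assms(1,2)
proof (induction F rule: finite_induct)
  case empty
  then show ?case using assms(3) by auto
next
  case (insert i F)
  then obtain U where U: "U \<in> \<S>" "(\<Union>i\<in>F. g i) \<subseteq> U" by auto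
  obtain V where "V \<in> \<S>" "g i \<union> U \<subseteq> V" using assms(4)[of "g i" U] insert U by auto
  then show ?case using U by (intro bexI[of _ V]) auto
qed

lemma Fin_seq_mono: "S \<subseteq> T \<Longrightarrow> Fin_seq S \<subseteq> Fin_seq T"
  unfolding Fin_seq_def by (intro Pi_mono Fpow_mono)

context Metric_space
begin

text \<open>The points \<open>x\<close> of \<open>E\<close> that are near \<open>K\<close> are finite in number; the \<open>n\<close>-th entry of the code of \<open>K\<close>
  is the union, over these \<open>x\<close>, of the finite codes of \<open>K\<close> that belong to the
  ball of radius \<open>\<rho> n\<close> around \<open>x\<close>. Conversely a sequence of finite subsets of \<open>\<sigma> x\<close> is reached by choosing a finite set in each of these balls: the
  union of the choices accumulates only at \<open>x\<close>, and is precompact. The family \<open>\<S>\<close> is directed because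
  several points of \<open>E\<close> may contribute to the same code.\<close>

lemma precompacts_onto_Fin_seqs:
  fixes \<S> :: "'b set set"
  assumes X: "X \<subseteq> M" and "0 < \<epsilon>"
    and E: "separated_by d \<epsilon> E"
    and \<S>: "\<S> \<noteq> {}" "\<And>S T. S \<in> \<S> \<Longrightarrow> T \<in> \<S> \<Longrightarrow> \<exists>U\<in>\<S>. S \<union> T \<subseteq> U"
    and \<sigma>: "\<And>x. x \<in> E \<Longrightarrow> \<sigma> x \<in> \<S>" "\<And>S. S \<in> \<S> \<Longrightarrow> \<exists>x\<in>E. S \<subseteq> \<sigma> x"
    and notb: "\<And>x r. x \<in> E \<Longrightarrow> 0 < r \<Longrightarrow> \<not> mtotally_bounded (X \<inter> mball x r)"
    and dens: "\<And>x r D. x \<in> E \<Longrightarrow> 0 < r \<Longrightarrow> D \<subseteq> X \<inter> mball x r \<Longrightarrow>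
                 X \<inter> mball x r \<subseteq> mtopology closure_of D \<Longrightarrow> |\<sigma> x| \<le>o |D|"
  shows "cof_maps_onto {K. K \<subseteq> X \<and> mtotally_bounded K} (\<Union>S\<in>\<S>. Fin_seq S)"
proof -
  define \<rho> where "\<rho> n = \<epsilon> / 3 / real (Suc n)" for n
  have \<rho>: "0 < \<rho> n" for n using \<open>0 < \<epsilon>\<close> by (simp add: \<rho>_def)
  have \<rho>_mono: "\<rho> n \<le> \<rho> m" if "m \<le> n" for m n
    unfolding \<rho>_def using that \<open>0 < \<epsilon>\<close> by (intro divide_left_mono) auto
  have \<rho>0: "\<rho> 0 = \<epsilon>/3" by (simp add: \<rho>_def)
  let ?Y = "\<lambda>x n. X \<inter> mball x (\<rho> n)"
  define codes where "codes x n \<phi> \<longleftrightarrow> (\<forall>K. mtotally_bounded K \<longrightarrow> \<phi> K \<in> Fpow (\<sigma> x)) \<and>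
      (\<forall>K L. mtotally_bounded L \<longrightarrow> K \<subseteq> L \<longrightarrow> \<phi> K \<subseteq> \<phi> L) \<and>
      (\<forall>G\<in>Fpow (\<sigma> x). \<exists>L\<subseteq>?Y x n. finite L \<and> G \<subseteq> \<phi> L)" for x n \<phi>
  have "\<exists>\<phi>. codes x n \<phi>" if "x \<in> E" for x n
    unfolding codes_def
  proof (rule finite_coding)
    show "?Y x n \<subseteq> M" using X by blast
    show "\<not> mtotally_bounded (?Y x n)" by (rule notb[OF that \<rho>])
    show "|\<sigma> x| \<le>o |D|" if "D \<subseteq> ?Y x n" "?Y x n \<subseteq> mtopology closure_of D" for D
      by (rule dens[OF \<open>x \<in> E\<close> \<rho> that])
  qed
  then obtain \<phi> where codes: "\<And>x n. x \<in> E \<Longrightarrow> codes x n (\<phi> x n)" by metis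
  have \<phi>: "\<And>x n K. x \<in> E \<Longrightarrow> mtotally_bounded K \<Longrightarrow> \<phi> x n K \<in> Fpow (\<sigma> x)"
      "\<And>x n K L. x \<in> E \<Longrightarrow> mtotally_bounded L \<Longrightarrow> K \<subseteq> L \<Longrightarrow> \<phi> x n K \<subseteq> \<phi> x n L"
      "\<And>x n G. x \<in> E \<Longrightarrow> G \<in> Fpow (\<sigma> x) \<Longrightarrow> \<exists>L\<subseteq>?Y x n. finite L \<and> G \<subseteq> \<phi> x n L"
    using codes unfolding codes_def by simp_all
  define near where "near K = {x\<in>E. K \<inter> mball x (\<epsilon>/3) \<noteq> {}}" for K
  define \<psi> where "\<psi> K n = (\<Union>x\<in>near K. \<phi> x n K)" for K n
  have near_mono: "near K \<subseteq> near L" if "K \<subseteq> L" for K L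
    unfolding near_def using that by blast
  show ?thesis
  proof (rule cof_maps_ontoI[where \<psi> = \<psi>])
    fix K assume "K \<in> {K. K \<subseteq> X \<and> mtotally_bounded K}"
    then have K: "mtotally_bounded K" by simp
    have fin: "finite (near K)"
      unfolding near_def by (rule finite_separated_near[OF K E \<open>0 < \<epsilon>\<close>])
    obtain S where S: "S \<in> \<S>" "(\<Union>x\<in>near K. \<sigma> x) \<subseteq> S"
      using directed_finite_Union[OF fin _ \<S>, of \<sigma>] \<sigma>(1) near_def by auto
    have "\<phi> x n K \<in> Fpow (\<sigma> x)" if "x \<in> near K" for x n
      using \<phi>(1) that K unfolding near_def by blast
    then have "\<psi> K n \<in> Fpow S" for n
      unfolding \<psi>_def Fpow_def using fin S(2) by fastforce
    then show "\<psi> K \<in> (\<Union>S\<in>\<S>. Fin_seq S)" using S(1) unfolding Fin_seq_def by blast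
  next
    fix K L assume "L \<in> {K. K \<subseteq> X \<and> mtotally_bounded K}" and "K \<le> L"
    then have L: "mtotally_bounded L" by simp
    have "\<phi> x n K \<subseteq> \<phi> x n L" if "x \<in> near K" for x n
      using \<phi>(2)[OF _ L \<open>K \<le> L\<close>] that unfolding near_def by blast
    then show "\<psi> K \<le> \<psi> L"
      unfolding \<psi>_def le_fun_def using near_mono[OF \<open>K \<le> L\<close>] by blast
  next
    fix f assume "f \<in> (\<Union>S\<in>\<S>. Fin_seq S)"
    then obtain S where S: "S \<in> \<S>" "f \<in> Fin_seq S" by blast
    then obtain x where x: "x \<in> E" "S \<subseteq> \<sigma> x" using \<sigma>(2) by blast
    then have f: "f n \<in> Fpow (\<sigma> x)" for n using S(2) Fpow_mono[OF x(2)] unfolding Fin_seq_def by blast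
    have "\<forall>n. \<exists>L\<subseteq>?Y x n. finite L \<and> f n \<subseteq> \<phi> x n L" using \<phi>(3)[OF x(1) f] by blast
    then obtain L where L: "\<And>n. L n \<subseteq> ?Y x n" "\<And>n. finite (L n)" "\<And>n. f n \<subseteq> \<phi> x n (L n)"
      by metis
    \<comment> \<open>If all \<open>f n\<close> are empty, the sets \<open>L n\<close> may be empty; \<open>p\<close> ensures that \<open>x\<close> is near \<open>K\<close> nevertheless.\<close>
    have "?Y x 0 \<noteq> {}" using notb[OF x(1) \<rho>, of 0] by auto
    then obtain p where p: "p \<in> ?Y x 0" by blast
    define K where "K = insert p (\<Union>n. L n)"
    have KX: "K \<subseteq> X" using p L(1) unfolding K_def by blast
    have "mtotally_bounded K"
    proof (rule mtotally_bounded_by_any_centres)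
      show "K \<subseteq> M" using KX X by blast
      fix r :: real assume "0 < r"
      then obtain k where "inverse (real (Suc k)) < r / (\<epsilon>/3)"
        using reals_Archimedean[of "r / (\<epsilon>/3)"] \<open>0 < \<epsilon>\<close> by auto
      then have k: "\<rho> k < r" using \<open>0 < \<epsilon>\<close> unfolding \<rho>_def by (simp add: field_simps)
      let ?F = "insert x (insert p (\<Union>n<k. L n))"
      have "finite ?F" using L(2) by simp
      moreover have "K \<subseteq> (\<Union>x\<in>?F. mball x r)"
      proof
        fix y assume "y \<in> K"
        then consider "y \<in> ?F" | n where "k \<le> n" "y \<in> L n"
          unfolding K_def by (auto simp: not_less[symmetric])
        then show "y \<in> (\<Union>x\<in>?F. mball x r)"
        proof cases
          case 1
          moreover have "y \<in> M" using \<open>y \<in> K\<close> KX X by blast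
          ultimately show ?thesis using \<open>0 < r\<close> by (intro UN_I[of y]) auto
        next
          case 2
          then have "y \<in> mball x (\<rho> n)" using L(1) by blast
          then have "y \<in> mball x r" using \<rho>_mono[OF 2(1)] k by auto
          then show ?thesis by blast
        qed
      qed
      ultimately show "\<exists>F. finite F \<and> K \<subseteq> (\<Union>x\<in>F. mball x r)" by blast
    qed
    moreover have "x \<in> near K"
      using x(1) p unfolding near_def K_def \<rho>0 by blast
    moreover have "L n \<subseteq> K" for n unfolding K_def by blast
    ultimately have "f n \<subseteq> \<psi> K n" for n
      using L(3)[of n] \<phi>(2)[OF x(1), of K "L n" n] unfolding \<psi>_def by blast
    then show "\<exists>K\<in>{K. K \<subseteq> X \<and> mtotally_bounded K}. f \<le> \<psi> K"
      using KX \<open>mtotally_bounded K\<close> by (intro bexI[of _ K]) (auto simp: le_fun_def)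
  qed
qed

text \<open>Via \<open>j\<close> the set \<open>T\<close> contains names of the balls \<open>B (p, n)\<close> with \<open>p \<in> D\<close>, and the members \<open>i\<close> of \<open>J\<close>
  are those whose ball lies in the closure of \<open>g i ` \<sigma> i\<close>. A pair \<open>(F, f)\<close> stands for the largest subset of \<open>X\<close>
  that, for each \<open>n\<close>, is covered by the \<open>1/(n+1)\<close>-balls around the points \<open>g i a\<close> with \<open>i\<close> named in \<open>F\<close>
  and \<open>a \<in> f n\<close>. Finitely many balls suffice for a given precompact set because its closure is
  compact; this is where completeness is used.\<close>

lemma Fpow_Times_Fin_seqs_onto_precompacts:
  fixes \<S> :: "'b set set" and T :: "'c set"
  assumes "mcomplete" "X \<subseteq> M"
    and D: "M \<subseteq> mtopology closure_of D" "|D| \<le>o |T|" "infinite T"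
    and \<S>: "\<S> \<noteq> {}" "\<And>S T. S \<in> \<S> \<Longrightarrow> T \<in> \<S> \<Longrightarrow> \<exists>U\<in>\<S>. S \<union> T \<subseteq> U"
    and loc: "\<And>x. x \<in> M \<Longrightarrow>
                \<exists>r>0. \<exists>S\<in>\<S>. \<exists>g. g ` S \<subseteq> M \<and> mball x r \<subseteq> mtopology closure_of (g ` S)"
  shows "cof_maps_onto (Fpow T \<times> (\<Union>S\<in>\<S>. Fin_seq S)) {K. K \<subseteq> X \<and> mtotally_bounded K}"
proof -
  define \<epsilon> where "\<epsilon> n = 1 / real (Suc n)" for n
  have \<epsilon>: "0 < \<epsilon> n" for n by (simp add: \<epsilon>_def)
  have small: "\<exists>k. \<epsilon> k < r" if "0 < r" for r
    unfolding \<epsilon>_def using reals_Archimedean[OF that] by (auto simp: inverse_eq_divide)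
  define I where "I = D \<times> (UNIV :: nat set)"
  have "|UNIV :: nat set| \<le>o |T|" using \<open>infinite T\<close> infinite_iff_card_of_nat by blast
  then have "|I| \<le>o |T|"
    unfolding I_def using D(2,3) by (intro card_of_Sigma_ordLeq_infinite) auto
  then obtain j where j: "inj_on j I" "j ` I \<subseteq> T" using card_of_ordLeq[of I T] by blast
  define B where "B i = mball (fst i) (\<epsilon> (snd i))" for i
  define good where "good i S g \<longleftrightarrow> S \<in> \<S> \<and> g ` S \<subseteq> M \<and> B i \<subseteq> mtopology closure_of (g ` S)"
    for i and S :: "'b set" and g
  define J where "J = {i\<in>I. \<exists>S g. good i S g}"
  have "\<forall>i. \<exists>S g. i \<in> J \<longrightarrow> good i S g" unfolding J_def by blast
  then obtain \<sigma> g where g: "\<And>i. i \<in> J \<Longrightarrow> good i (\<sigma> i) (g i)" by metis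
  have cover: "\<exists>i\<in>J. x \<in> B i" if x: "x \<in> M" for x
  proof -
    obtain r S h where r: "0 < r" "S \<in> \<S>" "h ` S \<subseteq> M" "mball x r \<subseteq> mtopology closure_of (h ` S)"
      using loc[OF x] by blast
    obtain n where n: "\<epsilon> n < r/2" using small[of "r/2"] r(1) by auto
    obtain p where p: "p \<in> D" "p \<in> M" "d p x < \<epsilon> n"
      using D(1) x \<epsilon>[of n] unfolding metric_closure_of by (force simp: commute)
    have "B (p, n) \<subseteq> mball x r"
    proof
      fix y assume "y \<in> B (p, n)"
      then have y: "y \<in> M" "d p y < \<epsilon> n" unfolding B_def by auto
      have "d x y \<le> d p x + d p y" using x p(2) y(1) triangle'' by blast
      then show "y \<in> mball x r" using x y p n by simp
    qed
    then have "good (p, n) S h" unfolding good_def using r by blast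
    then have "(p, n) \<in> J" unfolding J_def I_def using p(1) by auto
    moreover have "x \<in> B (p, n)" unfolding B_def using p x by simp
    ultimately show ?thesis by blast
  qed
  define \<psi> where "\<psi> = (\<lambda>(F, f). {x\<in>X. \<forall>n. \<exists>i\<in>I. j i \<in> F \<and> (\<exists>a\<in>f n. x \<in> mball (g i a) (\<epsilon> n))})"
  show ?thesis
  proof (rule cof_maps_ontoI[where \<psi> = \<psi>])
    fix q assume "q \<in> Fpow T \<times> (\<Union>S\<in>\<S>. Fin_seq S)"
    then obtain F f where q: "q = (F, f)" "finite F" "\<And>n. finite (f n)"
      unfolding Fpow_def Fin_seq_def by fastforce
    have "mtotally_bounded (\<psi> q)"
    proof (rule mtotally_bounded_by_any_centres)
      show "\<psi> q \<subseteq> M" using \<open>X \<subseteq> M\<close> unfolding q(1) \<psi>_def by auto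
      fix r :: real assume "0 < r"
      then obtain n where n: "\<epsilon> n < r" using small by blast
      let ?C = "(\<lambda>(i, a). g i a) ` ({i\<in>I. j i \<in> F} \<times> f n)"
      have "finite (j ` {i\<in>I. j i \<in> F})" by (rule finite_subset[OF _ q(2)]) auto
      moreover have "inj_on j {i\<in>I. j i \<in> F}" by (rule inj_on_subset[OF j(1)]) auto
      ultimately have "finite {i\<in>I. j i \<in> F}" by (rule finite_imageD)
      then have "finite ?C" using q(3) by simp
      moreover have "\<psi> q \<subseteq> (\<Union>c\<in>?C. mball c r)"
      proof
        fix x assume "x \<in> \<psi> q"
        then have "\<exists>i\<in>I. j i \<in> F \<and> (\<exists>a\<in>f n. x \<in> mball (g i a) (\<epsilon> n))"
          unfolding q(1) \<psi>_def by blast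
        then obtain i a where ia: "i \<in> I" "j i \<in> F" "a \<in> f n" "x \<in> mball (g i a) (\<epsilon> n)"
          by blast
        have "g i a \<in> ?C" using ia by force
        moreover have "x \<in> mball (g i a) r" using ia(4) n by simp
        ultimately show "x \<in> (\<Union>c\<in>?C. mball c r)" by blast
      qed
      ultimately show "\<exists>C. finite C \<and> \<psi> q \<subseteq> (\<Union>c\<in>C. mball c r)" by blast
    qed
    then show "\<psi> q \<in> {K. K \<subseteq> X \<and> mtotally_bounded K}" unfolding \<psi>_def q(1) by auto
  next
    fix q q' :: "'c set \<times> (nat \<Rightarrow> 'b set)" assume "q \<le> q'"
    then have "fst q \<subseteq> fst q'" "\<And>n. snd q n \<subseteq> snd q' n"
      by (auto simp: less_eq_prod_def le_fun_def)
    then show "\<psi> q \<le> \<psi> q'" unfolding \<psi>_def by (clarsimp simp: split_def) (meson subsetD)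
  next
    fix K assume "K \<in> {K. K \<subseteq> X \<and> mtotally_bounded K}"
    then have K: "K \<subseteq> X" "mtotally_bounded K" by auto
    let ?C = "mtopology closure_of K"
    have "compactin mtopology ?C"
      using K(2) mtotally_bounded_eq_compact_closure_of[OF \<open>mcomplete\<close>] by blast
    moreover have "\<And>U. U \<in> B ` J \<Longrightarrow> openin mtopology U" unfolding B_def by auto
    moreover have "?C \<subseteq> M" using closure_of_subset_topspace[of mtopology K] by simp
    then have "?C \<subseteq> \<Union>(B ` J)" using cover by blast
    ultimately have "\<exists>\<F>. finite \<F> \<and> \<F> \<subseteq> B ` J \<and> ?C \<subseteq> \<Union>\<F>"
      unfolding compactin_def by blast
    then obtain F0 where F0: "finite F0" "F0 \<subseteq> J" "?C \<subseteq> \<Union>(B ` F0)"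
      by (metis finite_subset_image)
    have KB: "K \<subseteq> \<Union>(B ` F0)"
      using F0(3) closure_of_subset[of K mtopology] K(1) \<open>X \<subseteq> M\<close> by auto
    have "\<exists>f. f \<in> Fpow (\<Union>i\<in>F0. \<sigma> i) \<and> (\<forall>x\<in>K. \<exists>i\<in>F0. \<exists>a\<in>f. x \<in> mball (g i a) (\<epsilon> n))" for n
    proof -
      obtain C where C: "finite C" "C \<subseteq> K" "K \<subseteq> (\<Union>c\<in>C. mball c (\<epsilon> n / 2))"
        using K(2) \<epsilon>[of n] unfolding mtotally_bounded_def by (metis half_gt_zero)
      have "\<exists>i a. i \<in> F0 \<and> a \<in> \<sigma> i \<and> g i a \<in> M \<and> d c (g i a) < \<epsilon> n / 2" if c: "c \<in> C" for c
      proof -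
        obtain i where i: "i \<in> F0" "c \<in> B i" using KB C(2) c by blast
        then have "c \<in> mtopology closure_of (g i ` \<sigma> i)"
          using g F0(2) unfolding good_def by blast
        then have "\<exists>a\<in>\<sigma> i. g i a \<in> mball c (\<epsilon> n / 2)"
          using half_gt_zero[OF \<epsilon>[of n]] unfolding metric_closure_of by blast
        then show ?thesis using i(1) unfolding in_mball by blast
      qed
      then obtain i a where ia: "\<And>c. c \<in> C \<Longrightarrow> i c \<in> F0 \<and> a c \<in> \<sigma> (i c) \<and>
          g (i c) (a c) \<in> M \<and> d c (g (i c) (a c)) < \<epsilon> n / 2"
        by metis
      have "a ` C \<in> Fpow (\<Union>i\<in>F0. \<sigma> i)" using ia C(1) unfolding Fpow_def by blast
      moreover have "\<exists>i\<in>F0. \<exists>b\<in>a ` C. x \<in> mball (g i b) (\<epsilon> n)" if "x \<in> K" for x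
      proof -
        obtain c where c: "c \<in> C" "x \<in> M" "c \<in> M" "d c x < \<epsilon> n / 2" using C(3) \<open>x \<in> K\<close> by auto
        have "d (g (i c) (a c)) x \<le> d c (g (i c) (a c)) + d c x"
          using ia[OF c(1)] c triangle'' by blast
        then have "x \<in> mball (g (i c) (a c)) (\<epsilon> n)" using ia[OF c(1)] c by simp
        then show ?thesis using ia[OF c(1)] c(1) by blast
      qed
      ultimately show ?thesis by blast
    qed
    then obtain f where f: "\<And>n. f n \<in> Fpow (\<Union>i\<in>F0. \<sigma> i)"
        "\<And>n x. x \<in> K \<Longrightarrow> \<exists>i\<in>F0. \<exists>a\<in>f n. x \<in> mball (g i a) (\<epsilon> n)"
      by metis
    obtain S where S: "S \<in> \<S>" "(\<Union>i\<in>F0. \<sigma> i) \<subseteq> S"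
      using directed_finite_Union[OF F0(1) _ \<S>, of \<sigma>] g F0(2) unfolding good_def by blast
    have F0I: "F0 \<subseteq> I" using F0(2) unfolding J_def by blast
    have "f \<in> Fin_seq S" using f(1) Fin_seq_mono[OF S(2)] unfolding Fin_seq_def by blast
    moreover have "j ` F0 \<in> Fpow T" using F0(1) j(2) F0I unfolding Fpow_def by blast
    moreover have "K \<subseteq> \<psi> (j ` F0, f)"
    proof
      fix x assume "x \<in> K"
      then have "\<exists>i\<in>I. j i \<in> j ` F0 \<and> (\<exists>a\<in>f n. x \<in> mball (g i a) (\<epsilon> n))" for n
        using f(2)[of x n] F0I by blast
      then show "x \<in> \<psi> (j ` F0, f)" using K(1) \<open>x \<in> K\<close> unfolding \<psi>_def by blast
    qed
    ultimately show "\<exists>q\<in>Fpow T \<times> (\<Union>S\<in>\<S>. Fin_seq S). K \<le> \<psi> q" using S(1) by blast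
  qed
qed

end

section \<open>Separated sets of unbounded rank\<close>

definition unbounded_on :: "'c rel \<Rightarrow> ('a \<Rightarrow> 'c) \<Rightarrow> 'a set \<Rightarrow> bool" where
  "unbounded_on r \<rho> U \<longleftrightarrow> (\<forall>b\<in>Field r. \<exists>x\<in>U. (b, \<rho> x) \<in> r)"

lemma unbounded_on_mono: "unbounded_on r \<rho> U \<Longrightarrow> U \<subseteq> V \<Longrightarrow> unbounded_on r \<rho> V"
  unfolding unbounded_on_def by blast

context Metric_space
begin

text \<open>Otherwise every unbounded set meets a ball of prescribed radius in an unbounded set. Iterating
  with radii tending to \<open>0\<close> gives centres that converge to a point all of whose neighbourhoods are
  unbounded.\<close>

lemma uniformly_locally_bounded_unbounded_set:
  assumes "mcomplete" "Field r \<noteq> {}" "unbounded_on r \<rho> M"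
    and loc: "\<And>y. y \<in> M \<Longrightarrow> \<exists>s>0. \<not> unbounded_on r \<rho> (mball y s)"
  shows "\<exists>U \<epsilon>. U \<subseteq> M \<and> 0 < \<epsilon> \<and> unbounded_on r \<rho> U \<and> (\<forall>y\<in>M. \<not> unbounded_on r \<rho> (U \<inter> mball y \<epsilon>))"
proof (rule ccontr)
  assume contra: "\<not> ?thesis"
  define \<epsilon> where "\<epsilon> n = 1 / real (Suc n)" for n
  have \<epsilon>: "0 < \<epsilon> n" for n by (simp add: \<epsilon>_def)
  have \<epsilon>_mono: "\<epsilon> n \<le> \<epsilon> m" if "m \<le> n" for m n
    unfolding \<epsilon>_def using that by (intro divide_left_mono) auto
  have small: "\<exists>k. \<epsilon> k < s" if "0 < s" for s
    unfolding \<epsilon>_def using reals_Archimedean[OF that] by (auto simp: inverse_eq_divide)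
  have "\<exists>y\<in>M. unbounded_on r \<rho> (U \<inter> mball y (\<epsilon> n))" if "U \<subseteq> M" "unbounded_on r \<rho> U" for U n
    using contra that \<epsilon>[of n] by blast
  then obtain c where c: "\<And>U n. U \<subseteq> M \<Longrightarrow> unbounded_on r \<rho> U \<Longrightarrow>
      c U n \<in> M \<and> unbounded_on r \<rho> (U \<inter> mball (c U n) (\<epsilon> n))"
    by metis
  define U where "U = rec_nat M (\<lambda>n V. V \<inter> mball (c V n) (\<epsilon> n))"
  have U0: "U 0 = M" and US: "U (Suc n) = U n \<inter> mball (c (U n) n) (\<epsilon> n)" for n
    unfolding U_def by simp_all
  define y where "y n = c (U n) n" for n
  have U: "U n \<subseteq> M \<and> unbounded_on r \<rho> (U n)" for n
  proof (induction n)
    case 0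
    then show ?case using U0 assms(3) by simp
  next
    case (Suc n)
    then show ?case using c[of "U n" n] US[of n] by auto
  qed
  have yM: "y n \<in> M" for n using c U unfolding y_def by blast
  have "decseq U" by (rule decseq_SucI) (simp add: US)
  have ball: "U (Suc n) \<subseteq> mball (y n) (\<epsilon> n)" for n unfolding US y_def by simp
  have near: "d (y m) (y n) \<le> 2 * \<epsilon> k" if "k \<le> m" "k \<le> n" for k m n
  proof -
    have "U (Suc (max m n)) \<noteq> {}"
      using U[of "Suc (max m n)"] \<open>Field r \<noteq> {}\<close> unfolding unbounded_on_def by blast
    then obtain p where "p \<in> U (Suc (max m n))" by blast
    then have "p \<in> U (Suc m)" "p \<in> U (Suc n)"
      using decseqD[OF \<open>decseq U\<close>, of "Suc m" "Suc (max m n)"]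
        decseqD[OF \<open>decseq U\<close>, of "Suc n" "Suc (max m n)"] by auto
    then have p: "p \<in> M" "d (y m) p < \<epsilon> m" "d (y n) p < \<epsilon> n" using ball[of m] ball[of n] by auto
    have "d (y m) (y n) \<le> d (y m) p + d (y n) p" using triangle' yM p(1) by blast
    then show ?thesis using p \<epsilon>_mono[OF that(1)] \<epsilon>_mono[OF that(2)] by linarith
  qed
  have "MCauchy y"
    unfolding MCauchy_def
  proof (intro conjI allI impI)
    show "range y \<subseteq> M" using yM by blast
    fix s :: real assume "0 < s"
    then obtain k where k: "\<epsilon> k < s / 2" using small[of "s/2"] by auto
    then have "d (y m) (y n) < s" if "k \<le> m" "k \<le> n" for m n
      using near[OF that] by linarith
    then show "\<exists>k. \<forall>m n. k \<le> m \<longrightarrow> k \<le> n \<longrightarrow> d (y m) (y n) < s" by blast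
  qed
  then obtain l where "limitin mtopology y l sequentially"
    using \<open>mcomplete\<close> unfolding mcomplete_def by blast
  then have l: "l \<in> M" "\<And>s. 0 < s \<Longrightarrow> \<exists>k. \<forall>n\<ge>k. d (y n) l < s"
    unfolding limit_metric_sequentially by blast+
  obtain s where s: "0 < s" "\<not> unbounded_on r \<rho> (mball l s)" using loc[OF l(1)] by blast
  obtain k where k: "\<And>n. k \<le> n \<Longrightarrow> d (y n) l < s/2" using l(2)[of "s/2"] s(1) by auto
  obtain k' where k': "\<epsilon> k' < s/2" using small[of "s/2"] s(1) by auto
  define n where "n = max k k'"
  have n: "d (y n) l < s/2" "\<epsilon> n < s/2"
    using k[of n] k' \<epsilon>_mono[of k' n] unfolding n_def by auto
  have "U (Suc n) \<subseteq> mball l s"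
  proof
    fix p assume "p \<in> U (Suc n)"
    then have p: "p \<in> M" "d (y n) p < \<epsilon> n" using ball[of n] by auto
    have "d l p \<le> d (y n) l + d (y n) p" using triangle'' l(1) p(1) yM by blast
    then show "p \<in> mball l s" using p l(1) n by simp
  qed
  then show False using unbounded_on_mono U s(2) by blast
qed

text \<open>Enumerate a cofinal subset \<open>Z\<close> of \<open>r\<close> of minimal cardinality in the order type of that cardinal,
  and choose recursively \<open>f z \<in> U\<close> of rank at least \<open>z\<close> outside the \<open>\<epsilon>\<close>-balls around the earlier
  choices. The choice is possible because \<open>U\<close> is bounded in each of these balls and there are
  fewer than \<open>|Z|\<close> of them, so that, by minimality, their bounds are not cofinal.\<close>

lemma separated_unbounded_set:
  fixes r :: "'c rel"
  assumes r: "Well_order r" and "U \<subseteq> M"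
    and unb: "unbounded_on r \<rho> U"
    and loc: "\<And>y. y \<in> U \<Longrightarrow> \<not> unbounded_on r \<rho> (U \<inter> mball y \<epsilon>)"
  shows "\<exists>E\<subseteq>U. separated_by d \<epsilon> E \<and> unbounded_on r \<rho> E"
proof -
  have trans_r: "(a, c) \<in> r" if "(a, b) \<in> r" "(b, c) \<in> r" for a b c
    using r that unfolding order_on_defs trans_def by blast
  have total_r: "(a, b) \<in> r \<or> (b, a) \<in> r" if "a \<in> Field r" "b \<in> Field r" for a b
    using r that unfolding order_on_defs total_on_def refl_on_def by (cases "a = b") blast+
  let ?cof = "\<lambda>Z. Z \<subseteq> Field r \<and> unbounded_on r id Z"
  have "unbounded_on r id (Field r)"
    unfolding unbounded_on_def using total_r by fastforce
  then have "{|Z| | Z. ?cof Z} \<noteq> {}" by blast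
  then have "\<exists>p\<in>{|Z| | Z. ?cof Z}. \<forall>p'\<in>{|Z| | Z. ?cof Z}. p \<le>o p'"
    by (rule exists_minim_Card_order) (auto simp: card_of_Card_order)
  then obtain Z where Z: "?cof Z" and min: "\<And>Z'. ?cof Z' \<Longrightarrow> |Z| \<le>o |Z'|" by blast
  define w where "w = |Z|"
  have w: "Card_order w" "Field w = Z" "Well_order w"
    unfolding w_def by (rule card_of_Card_order Field_card_of card_of_Well_order)+
  define P where "P f z y \<longleftrightarrow> (z \<in> Z \<longrightarrow> y \<in> U \<and> (z, \<rho> y) \<in> r \<and> (\<forall>v. (v, z) \<in> w - Id \<longrightarrow> y \<notin> mball (f v) \<epsilon>))"
    for f z y
  have "\<exists>f. \<forall>z. P f z (f z)"
  proof (rule dependent_wf_choice)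
    show "wf (w - Id)" using w(3) unfolding well_order_on_def by blast
    show "P f z y = P g z y" if "\<And>v. (v, z) \<in> w - Id \<Longrightarrow> f v = g v" for f g z y
      unfolding P_def using that by auto
    show "\<exists>y. P f z y" if IH: "\<And>v. (v, z) \<in> w - Id \<Longrightarrow> P f v (f v)" for z f
    proof (cases "z \<in> Z")
      case True
      have v: "f v \<in> U" if "v \<in> underS w z" for v
      proof -
        have "(v, z) \<in> w - Id" using that unfolding underS_def by blast
        moreover have "v \<in> Z" using that w(2) unfolding underS_def Field_def by blast
        ultimately show ?thesis using IH[of v] unfolding P_def by blast
      qed
      have "\<exists>c\<in>Field r. \<forall>x\<in>U \<inter> mball (f v) \<epsilon>. (c, \<rho> x) \<notin> r" if "v \<in> underS w z" for v
        using loc[OF v[OF that]] unfolding unbounded_on_def by blast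
      then obtain c where c: "\<And>v. v \<in> underS w z \<Longrightarrow> c v \<in> Field r"
          "\<And>v x. v \<in> underS w z \<Longrightarrow> x \<in> U \<inter> mball (f v) \<epsilon> \<Longrightarrow> (c v, \<rho> x) \<notin> r"
        by metis
      have "|c ` underS w z| \<le>o |underS w z|" by (rule card_of_image)
      also have "|underS w z| <o |Z|" using card_of_underS[OF w(1), of z] True w(2) unfolding w_def by simp
      finally have "\<not> |Z| \<le>o |c ` underS w z|" using not_ordLess_ordLeq by blast
      then have "\<not> unbounded_on r id (c ` underS w z)" using min c(1) by blast
      then obtain b where b: "b \<in> Field r" "\<And>v. v \<in> underS w z \<Longrightarrow> (b, c v) \<notin> r"
        unfolding unbounded_on_def by auto
      have zF: "z \<in> Field r" using True Z by blast
      obtain m where m: "m \<in> Field r" "(b, m) \<in> r" "(z, m) \<in> r"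
        using total_r[OF b(1) zF] total_r[OF b(1) b(1)] total_r[OF zF zF] b(1) zF by blast
      obtain y where y: "y \<in> U" "(m, \<rho> y) \<in> r" using unb m(1) unfolding unbounded_on_def by blast
      have "y \<notin> mball (f v) \<epsilon>" if "v \<in> underS w z" for v
      proof
        assume "y \<in> mball (f v) \<epsilon>"
        then have "(c v, \<rho> y) \<notin> r" using c(2)[OF that] y(1) by blast
        moreover have "(c v, b) \<in> r" using total_r[OF c(1)[OF that] b(1)] b(2)[OF that] by blast
        ultimately show False using trans_r m(2) y(2) by blast
      qed
      then have "\<forall>v. (v, z) \<in> w - Id \<longrightarrow> y \<notin> mball (f v) \<epsilon>" unfolding underS_def by blast
      then show ?thesis unfolding P_def using y trans_r m(3) by blast
    qed (simp add: P_def)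
  qed
  then obtain f where f: "\<And>z. z \<in> Z \<Longrightarrow> f z \<in> U \<and> (z, \<rho> (f z)) \<in> r"
      "\<And>z v. z \<in> Z \<Longrightarrow> (v, z) \<in> w - Id \<Longrightarrow> f z \<notin> mball (f v) \<epsilon>"
    unfolding P_def by blast
  have apart: "\<epsilon> \<le> d (f v) (f z)" if "z \<in> Z" "v \<in> Z" "(v, z) \<in> w" "f v \<noteq> f z" for v z
  proof -
    have "(v, z) \<in> w - Id" using that by blast
    then have "f z \<notin> mball (f v) \<epsilon>" using f(2) that(1) by blast
    moreover have "f z \<in> M" "f v \<in> M" using f(1) that \<open>U \<subseteq> M\<close> by auto
    ultimately show ?thesis by simp
  qed
  have "separated_by d \<epsilon> (f ` Z)"
    unfolding separated_by_def
  proof (intro ballI impI)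
    fix a b assume "a \<in> f ` Z" "b \<in> f ` Z" "a \<noteq> b"
    then obtain v z where vz: "v \<in> Z" "z \<in> Z" "a = f v" "b = f z" by blast
    have "total_on Z w" using w(2,3) unfolding well_order_on_def linear_order_on_def by simp
    moreover have "v \<noteq> z" using vz \<open>a \<noteq> b\<close> by blast
    ultimately have "(v, z) \<in> w \<or> (z, v) \<in> w" using vz unfolding total_on_def by blast
    then show "\<epsilon> \<le> d a b"
      using apart[of v z] apart[of z v] vz \<open>a \<noteq> b\<close> commute[of a b] by auto
  qed
  moreover have "f ` Z \<subseteq> U" using f(1) by blast
  moreover have "unbounded_on r \<rho> (f ` Z)"
    unfolding unbounded_on_def
  proof
    fix b assume "b \<in> Field r"
    then obtain z where "z \<in> Z" "(b, z) \<in> r" using Z unfolding unbounded_on_def by auto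
    then show "\<exists>x\<in>f ` Z. (b, \<rho> x) \<in> r" using f(1) trans_r by blast
  qed
  ultimately show ?thesis by blast
qed

end

section \<open>Local density in metric spaces\<close>

context Metric_space
begin

lemma local_density_at_dense_set:
  assumes "x \<in> M"
  obtains r A where "0 < r" "A \<subseteq> M" "mball x r \<subseteq> mtopology closure_of A" "local_density_at mtopology x = |A|"
proof -
  have x: "x \<in> topspace mtopology" using assms by simp
  obtain U where U: "neighborhood_of mtopology x U"
      "local_density_at mtopology x = density_card (subtopology mtopology U)"
    using local_density_at(1)[OF x] by blast
  have UM: "U \<subseteq> M" using U(1) unfolding neighborhood_of_def by simp
  obtain A where A: "dense_in (subtopology mtopology U) A" "density_card (subtopology mtopology U) = |A|"
    using density_card(1) by blast
  have "A \<subseteq> U" and "subtopology mtopology U closure_of A = U"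
    using A(1) UM unfolding dense_in_def by (auto simp: Int_absorb1)
  then have cl: "U \<subseteq> mtopology closure_of A"
    by (metis closure_of_subtopology_subset)
  obtain r where r: "0 < r" "mball x r \<subseteq> U"
    using U(1) unfolding neighborhood_of_def openin_mtopology by (meson order_trans)
  show ?thesis
    using that[of r A] r cl \<open>A \<subseteq> U\<close> UM U(2) A(2) by (metis order_trans)
qed

lemma Card_order_local_density_at:
  assumes "x \<in> M" shows "Card_order (local_density_at mtopology x)"
  by (rule local_density_at_dense_set[OF assms]) (simp only: card_of_Card_order)

text \<open>A dense subset of the trace of a ball on the dense set \<open>X\<close> is dense in the ball.\<close>

lemma local_density_at_le_card:
  assumes X: "X \<subseteq> M" "M \<subseteq> mtopology closure_of X" and x: "x \<in> M" "0 < r"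
    and D: "D \<subseteq> X \<inter> mball x r" "X \<inter> mball x r \<subseteq> mtopology closure_of D"
  shows "local_density_at mtopology x \<le>o |D|"
proof -
  let ?B = "mball x r"
  have "?B \<subseteq> mtopology closure_of (X \<inter> ?B)"
  proof -
    have "?B \<subseteq> ?B \<inter> mtopology closure_of X" using X(2) by auto
    also have "\<dots> \<subseteq> mtopology closure_of (?B \<inter> X)" by (rule openin_Int_closure_of_subset) simp
    finally show ?thesis by (simp add: Int_commute)
  qed
  also have "\<dots> \<subseteq> mtopology closure_of D"
    using closure_of_mono[OF D(2), of mtopology] by simp
  finally have cl: "?B \<subseteq> mtopology closure_of D" .
  have DB: "D \<subseteq> ?B" using D(1) by blast
  have BM: "?B \<subseteq> M" by auto
  have "dense_in (subtopology mtopology ?B) D"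
    unfolding dense_in_def closure_of_subtopology
    using cl DB BM by (auto simp: Int_absorb1)
  then have le: "density_card (subtopology mtopology ?B) \<le>o |D|" by (rule density_card(2))
  have nb: "neighborhood_of mtopology x ?B"
    unfolding neighborhood_of_def using BM x by (intro conjI exI[of _ ?B]) auto
  have "x \<in> topspace mtopology" using x(1) by simp
  from ordLeq_transitive[OF local_density_at(2)[OF this nb] le] show ?thesis .
qed

text \<open>A neighbourhood of \<open>y\<close> is also a neighbourhood of all points close to \<open>y\<close>.\<close>

lemma local_density_at_upper_semicontinuous:
  assumes "y \<in> M"
  shows "\<exists>s>0. \<forall>x\<in>mball y s. local_density_at mtopology x \<le>o local_density_at mtopology y"
proof -
  have y: "y \<in> topspace mtopology" using assms by simp
  obtain U where U: "neighborhood_of mtopology y U"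
      "local_density_at mtopology y = density_card (subtopology mtopology U)"
    using local_density_at(1)[OF y] by blast
  obtain V where V: "openin mtopology V" "y \<in> V" "V \<subseteq> U" "U \<subseteq> M"
    using U(1) unfolding neighborhood_of_def by auto
  obtain s where s: "0 < s" "mball y s \<subseteq> V" using V(1,2) unfolding openin_mtopology by blast
  have "local_density_at mtopology x \<le>o local_density_at mtopology y" if "x \<in> mball y s" for x
  proof -
    have "x \<in> V" and x: "x \<in> topspace mtopology" using s(2) that by auto
    then have "neighborhood_of mtopology x U"
      unfolding neighborhood_of_def using V(1,3,4) by (intro conjI exI[of _ V]) auto
    then show ?thesis using local_density_at(2)[OF x] U(2) by metis
  qed
  then show ?thesis using s(1) by blast
qed

lemma finite_dense_imp_mtotally_bounded:
  assumes "finite A" "A \<subseteq> M" "Y \<subseteq> mtopology closure_of A"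
  shows "mtotally_bounded Y"
  using mtotally_bounded_subset[OF mtotally_bounded_closure_of[OF finite_imp_mtotally_bounded[OF assms(1,2)]] assms(3)] .

lemma mtotally_bounded_countable_dense:
  assumes "mtotally_bounded Y"
  obtains D where "countable D" "D \<subseteq> Y" "Y \<subseteq> mtopology closure_of D"
proof -
  define \<epsilon> where "\<epsilon> n = 1 / real (Suc n)" for n
  have "0 < \<epsilon> n" for n by (simp add: \<epsilon>_def)
  then have "\<forall>n. \<exists>F. finite F \<and> F \<subseteq> Y \<and> Y \<subseteq> (\<Union>x\<in>F. mball x (\<epsilon> n))"
    using assms unfolding mtotally_bounded_def by blast
  then obtain F where F: "\<And>n. finite (F n)" "\<And>n. F n \<subseteq> Y" "\<And>n. Y \<subseteq> (\<Union>x\<in>F n. mball x (\<epsilon> n))"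
    by metis
  have "Y \<subseteq> mtopology closure_of (\<Union>n. F n)"
  proof
    fix y assume y: "y \<in> Y"
    then have "y \<in> M" using mtotally_bounded_imp_subset[OF assms] by blast
    moreover have "\<exists>x\<in>(\<Union>n. F n). x \<in> mball y r" if "0 < r" for r
    proof -
      obtain n where n: "\<epsilon> n < r"
        unfolding \<epsilon>_def using reals_Archimedean[OF \<open>0 < r\<close>] by (auto simp: inverse_eq_divide)
      obtain x where x: "x \<in> F n" "x \<in> M" "d x y < \<epsilon> n" using F(3)[of n] y by auto
      then have "x \<in> mball y r" using n \<open>y \<in> M\<close> commute[of x y] by simp
      then show ?thesis using x(1) by blast
    qed
    ultimately show "y \<in> mtopology closure_of (\<Union>n. F n)" unfolding metric_closure_of by blast
  qed
  moreover have "countable (\<Union>n. F n)" using F(1) by (auto intro: countable_finite)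
  moreover have "(\<Union>n. F n) \<subseteq> Y" using F(2) by blast
  ultimately show ?thesis using that by blast
qed

text \<open>The trace on \<open>X\<close> of a ball in \<open>M\<close> is dense in the ball. If it is precompact, then its
  closure is a compact neighbourhood of the centre.\<close>

lemma not_locally_compact_point:
  assumes "mcomplete" and X: "X \<subseteq> M" "M \<subseteq> mtopology closure_of X"
    and "\<not> locally_compact_space mtopology"
  shows "\<exists>x\<in>M. \<forall>r>0. \<not> mtotally_bounded (X \<inter> mball x r)"
proof (rule ccontr)
  assume "\<not> ?thesis"
  then have tb: "\<exists>r>0. mtotally_bounded (X \<inter> mball x r)" if "x \<in> M" for x using that by blast
  have "locally_compact_space mtopology"
    unfolding locally_compact_space_def
  proof
    fix x assume "x \<in> topspace mtopology"
    then have x: "x \<in> M" by simp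
    obtain r where r: "0 < r" "mtotally_bounded (X \<inter> mball x r)" using tb[OF x] by blast
    have "mball x r \<subseteq> mball x r \<inter> mtopology closure_of X" using X(2) by auto
    also have "\<dots> \<subseteq> mtopology closure_of (mball x r \<inter> X)" by (rule openin_Int_closure_of_subset) simp
    finally have "mball x r \<subseteq> mtopology closure_of (X \<inter> mball x r)" by (simp add: Int_commute)
    moreover have "compactin mtopology (mtopology closure_of (X \<inter> mball x r))"
      using r(2) mtotally_bounded_eq_compact_closure_of[OF \<open>mcomplete\<close>] by blast
    ultimately show "\<exists>U K. openin mtopology U \<and> compactin mtopology K \<and> x \<in> U \<and> U \<subseteq> K"
      using x r(1) by (intro exI[of _ "mball x r"] exI[of _ "mtopology closure_of (X \<inter> mball x r)"]) auto
  qed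
  then show False using assms(4) by blast
qed

lemma local_density_at_infinite:
  assumes "x \<in> M" "\<And>r. 0 < r \<Longrightarrow> \<not> mtotally_bounded (X \<inter> mball x r)"
  shows "infinite (Field (local_density_at mtopology x))"
proof
  obtain r A where A: "0 < r" "A \<subseteq> M" "mball x r \<subseteq> mtopology closure_of A"
      "local_density_at mtopology x = |A|"
    using local_density_at_dense_set[OF assms(1)] .
  assume "finite (Field (local_density_at mtopology x))"
  then have "finite A" using A(4) by (simp add: Field_card_of)
  then have "mtotally_bounded (X \<inter> mball x r)"
    using finite_dense_imp_mtotally_bounded[OF _ A(2), of "X \<inter> mball x r"] A(3) by blast
  then show False using assms(2)[OF A(1)] by blast
qed

text \<open>A precompact set is separable.\<close>

lemma uncountable_local_density_at:
  assumes X: "X \<subseteq> M" "M \<subseteq> mtopology closure_of X" and x: "x \<in> M" "0 < r"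
    and unc: "uncountable (Field (local_density_at mtopology x))"
  shows "\<not> mtotally_bounded (X \<inter> mball x r)"
proof
  assume "mtotally_bounded (X \<inter> mball x r)"
  then obtain D where D: "countable D" "D \<subseteq> X \<inter> mball x r" "X \<inter> mball x r \<subseteq> mtopology closure_of D"
    by (rule mtotally_bounded_countable_dense)
  have "local_density_at mtopology x \<le>o |D|" by (rule local_density_at_le_card[OF X x D(2,3)])
  moreover obtain A where "local_density_at mtopology x = |A|"
    using local_density_at_dense_set[OF x(1)] by metis
  ultimately have "|A| \<le>o |D|" "uncountable A" using unc by (simp_all add: Field_card_of)
  then show False
    using D(1) card_of_ordLeq[of A D] countable_image_inj_on countable_subset by metis
qed

end

section \<open>Precompact subsets of a dense subspace\<close>

text \<open>All entries of a sequence lie in one countable set, which is not cofinal.\<close>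

lemma Bdd_Fin_seq_eq_Fin_seq:
  assumes "Card_order \<kappa>" "infinite (Field \<kappa>)" "uncountable_cofinality \<kappa>"
  shows "Bdd_Fin_seq \<kappa> = Fin_seq (Field \<kappa>)"
proof
  show "Bdd_Fin_seq \<kappa> \<subseteq> Fin_seq (Field \<kappa>)"
    unfolding Bdd_Fin_seq_def by (intro UN_least Fin_seq_mono) (auto simp: underS_def Field_def)
  show "Fin_seq (Field \<kappa>) \<subseteq> Bdd_Fin_seq \<kappa>"
  proof
    fix f assume f: "f \<in> Fin_seq (Field \<kappa>)"
    then have fn: "finite (f n)" "f n \<subseteq> Field \<kappa>" for n unfolding Fin_seq_def Fpow_def by auto
    have "countable (\<Union>n. f n)" using fn(1) by (auto intro: countable_finite)
    then have "\<not> cofinal (\<Union>n. f n) \<kappa>"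
      using assms(3) fn(2) unfolding uncountable_cofinality_def by blast
    then obtain a where a: "a \<in> Field \<kappa>" "\<And>n b. b \<in> f n \<Longrightarrow> \<not> (a \<noteq> b \<and> (a, b) \<in> \<kappa>)"
      unfolding cofinal_def by blast
    have wo: "wo_rel \<kappa>" using assms(1) unfolding card_order_on_def wo_rel_def by blast
    obtain c where c: "c \<in> Field \<kappa>" "a \<noteq> c" "(a, c) \<in> \<kappa>"
      using infinite_Card_order_limit[OF assms(1,2) a(1)] by blast
    have "f n \<subseteq> underS \<kappa> c" for n
    proof
      fix b assume b: "b \<in> f n"
      then have "(b, a) \<in> \<kappa>"
        using a fn(2)[of n] wo_rel.TOTALS[OF wo] by (metis subsetD)
      then have "(b, c) \<in> \<kappa>" using c(3) wo_rel.TRANS[OF wo] unfolding trans_def by blast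
      moreover have "b \<noteq> c"
        using \<open>(b, a) \<in> \<kappa>\<close> c(2,3) wo_rel.ANTISYM[OF wo] unfolding antisym_def by blast
      ultimately show "b \<in> underS \<kappa> c" unfolding underS_def by blast
    qed
    then have "f \<in> Fin_seq (underS \<kappa> c)" using fn(1) unfolding Fin_seq_def Fpow_def by blast
    then show "f \<in> Bdd_Fin_seq \<kappa>" using c(1) unfolding Bdd_Fin_seq_def by blast
  qed
qed

text \<open>The set \<open>T\<close> stands for the density of \<open>X\<close>: its cardinality is the least cardinality of a dense
  subset of \<open>X\<close>.\<close>

locale dense_subspace = Metric_space M d for M :: "'b set" and d +
  fixes X :: "'b set" and T :: "'c set"
  assumes complete: "mcomplete"
    and not_lc: "\<not> locally_compact_space mtopology"
    and X: "X \<subseteq> M" "M \<subseteq> mtopology closure_of X"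
    and T: "\<exists>D\<subseteq>X. X \<subseteq> mtopology closure_of D \<and> |D| \<le>o |T|"
    and T_le: "\<And>D. D \<subseteq> X \<Longrightarrow> X \<subseteq> mtopology closure_of D \<Longrightarrow> |T| \<le>o |D|"
begin

abbreviation ld :: "'b \<Rightarrow> 'b rel" where "ld \<equiv> local_density_at mtopology"

abbreviation ldens :: "'b rel" where "ldens \<equiv> local_density mtopology"

abbreviation precompacts :: "'b set set" where
  "precompacts \<equiv> {K. K \<subseteq> X \<and> mtotally_bounded K}"

lemma Card_order_image_ld:
  assumes "s \<in> ld ` topspace mtopology" shows "Card_order s"
proof -
  obtain x where "s = ld x" "x \<in> M" using assms unfolding topspace_mtopology by (elim imageE)
  then show ?thesis using Card_order_local_density_at[of x] by simp
qed

lemma Card_order_ldens: "Card_order ldens"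
  unfolding local_density_def by (rule card_Sup(1)) (rule Card_order_image_ld)

lemma ld_le_ldens:
  assumes "x \<in> M" shows "ld x \<le>o ldens"
  unfolding local_density_def using assms
  by (intro card_Sup(2) Card_order_image_ld imageI) simp_all

lemma ldens_least:
  fixes r :: "'b rel"
  assumes "Card_order r" "\<And>x. x \<in> M \<Longrightarrow> ld x \<le>o r" shows "ldens \<le>o r"
  unfolding local_density_def
proof (rule card_Sup(3))
  fix s assume "s \<in> ld ` topspace mtopology"
  then obtain x where "s = ld x" "x \<in> M" unfolding topspace_mtopology by (elim imageE)
  then show "s \<le>o r" using assms(2)[of x] by simp
qed (use assms(1) Card_order_image_ld in blast)+

lemma not_precompact_point: "\<exists>x\<in>M. \<forall>r>0. \<not> mtotally_bounded (X \<inter> mball x r)"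
  by (rule not_locally_compact_point[OF complete X not_lc])

lemma ball_dense_image:
  fixes S :: "'e set"
  assumes "x \<in> M" "ld x \<le>o |S|"
  shows "\<exists>r>0. \<exists>g. g ` S \<subseteq> M \<and> mball x r \<subseteq> mtopology closure_of (g ` S)"
proof -
  obtain r A where A: "0 < r" "A \<subseteq> M" "mball x r \<subseteq> mtopology closure_of A" "ld x = |A|"
    using local_density_at_dense_set[OF assms(1)] .
  have "x \<in> mball x r" using A(1) assms(1) by simp
  then have "x \<in> mtopology closure_of A" using A(3) by blast
  then have "A \<noteq> {}" using closure_of_empty[of mtopology] by blast
  moreover have "|A| \<le>o |S|" using assms(2) unfolding A(4) .
  ultimately obtain g where "g ` S = A" using card_of_ordLeq2[of A S] by blast
  then show ?thesis using A by blast
qed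

text \<open>The two families \<open>\<S>\<close> of interest are \<open>{Field ldens}\<close>, with a single point in \<open>E\<close>, and the family of
  proper initial segments of \<open>ldens\<close>. The hypotheses on \<open>E\<close> yield the map from precompact sets to
  codes, the last hypothesis the map in the other direction.\<close>

lemma precompacts_cof_equiv:
  fixes \<S> :: "'e set set"
  assumes "0 < \<epsilon>" and E: "separated_by d \<epsilon> E"
    and \<S>: "\<S> \<noteq> {}" "\<And>S T. S \<in> \<S> \<Longrightarrow> T \<in> \<S> \<Longrightarrow> \<exists>U\<in>\<S>. S \<union> T \<subseteq> U"
    and \<sigma>: "\<And>x. x \<in> E \<Longrightarrow> \<sigma> x \<in> \<S>" "\<And>S. S \<in> \<S> \<Longrightarrow> \<exists>x\<in>E. S \<subseteq> \<sigma> x"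
    and notb: "\<And>x r. x \<in> E \<Longrightarrow> 0 < r \<Longrightarrow> \<not> mtotally_bounded (X \<inter> mball x r)"
    and dens: "\<And>x r D. x \<in> E \<Longrightarrow> 0 < r \<Longrightarrow> D \<subseteq> X \<inter> mball x r \<Longrightarrow>
                 X \<inter> mball x r \<subseteq> mtopology closure_of D \<Longrightarrow> |\<sigma> x| \<le>o |D|"
    and loc: "\<And>x. x \<in> M \<Longrightarrow> \<exists>S\<in>\<S>. ld x \<le>o |S|"
  shows "cof_equiv precompacts (Fpow T \<times> (\<Union>S\<in>\<S>. Fin_seq S))"
  unfolding cof_equiv_def
proof
  obtain x where x: "x \<in> M" "\<not> mtotally_bounded (X \<inter> mball x 1)"
    using not_precompact_point by force
  then have notbX: "\<not> mtotally_bounded X" using mtotally_bounded_subset[of X] by blast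
  have "\<exists>\<phi>. (\<forall>K. mtotally_bounded K \<longrightarrow> \<phi> K \<in> Fpow T) \<and>
          (\<forall>K L. mtotally_bounded L \<longrightarrow> K \<subseteq> L \<longrightarrow> \<phi> K \<subseteq> \<phi> L) \<and>
          (\<forall>G\<in>Fpow T. \<exists>L\<subseteq>X. finite L \<and> G \<subseteq> \<phi> L)"
    by (rule finite_coding[OF X(1) notbX T_le])
  then obtain \<phi> where "(\<forall>K. mtotally_bounded K \<longrightarrow> \<phi> K \<in> Fpow T) \<and>
          (\<forall>K L. mtotally_bounded L \<longrightarrow> K \<subseteq> L \<longrightarrow> \<phi> K \<subseteq> \<phi> L) \<and>
          (\<forall>G\<in>Fpow T. \<exists>L\<subseteq>X. finite L \<and> G \<subseteq> \<phi> L)" by (elim exE)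
  then have \<phi>: "\<And>K. mtotally_bounded K \<Longrightarrow> \<phi> K \<in> Fpow T"
      "\<And>K L. mtotally_bounded L \<Longrightarrow> K \<subseteq> L \<Longrightarrow> \<phi> K \<subseteq> \<phi> L"
      "\<And>G. G \<in> Fpow T \<Longrightarrow> \<exists>L\<subseteq>X. finite L \<and> G \<subseteq> \<phi> L"
    by simp_all
  have "cof_maps_onto precompacts (Fpow T)"
  proof (rule cof_maps_ontoI[where \<psi> = \<phi>])
    fix G assume "G \<in> Fpow T"
    then obtain L where L: "L \<subseteq> X" "finite L" "G \<subseteq> \<phi> L" using \<phi>(3) by blast
    then have "mtotally_bounded L" using X(1) finite_imp_mtotally_bounded by auto
    then show "\<exists>L\<in>precompacts. G \<subseteq> \<phi> L" using L by blast
  qed (use \<phi> in auto)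
  moreover have "cof_maps_onto precompacts (\<Union>S\<in>\<S>. Fin_seq S)"
    by (rule precompacts_onto_Fin_seqs[where \<sigma> = \<sigma>, OF X(1) \<open>0 < \<epsilon>\<close> E \<S> \<sigma> notb dens])
  ultimately show "cof_maps_onto precompacts (Fpow T \<times> (\<Union>S\<in>\<S>. Fin_seq S))"
  proof (rule cof_maps_onto_Times)
    fix K L assume "K \<in> precompacts" "L \<in> precompacts"
    then show "\<exists>U\<in>precompacts. K \<subseteq> U \<and> L \<subseteq> U"
      by (intro bexI[of _ "K \<union> L"]) (auto intro: mtotally_bounded_Un)
  qed
next
  obtain D where D: "D \<subseteq> X" "X \<subseteq> mtopology closure_of D" "|D| \<le>o |T|" using T by blast
  have "M \<subseteq> mtopology closure_of D"
    using X(2) closure_of_mono[OF D(2), of mtopology] by simp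
  moreover have "infinite T"
  proof
    have DM: "D \<subseteq> M" using D(1) X(1) by blast
    assume "finite T"
    then have "finite D" using D(3) card_of_ordLeq_finite by blast
    then have "mtotally_bounded X" using finite_dense_imp_mtotally_bounded DM D(2) by blast
    then show False using not_precompact_point mtotally_bounded_subset[of X] zero_less_one by blast
  qed
  ultimately show "cof_maps_onto (Fpow T \<times> (\<Union>S\<in>\<S>. Fin_seq S)) precompacts"
  proof (intro Fpow_Times_Fin_seqs_onto_precompacts[where D = D] complete X(1) D(3) \<S>)
    show "\<exists>r>0. \<exists>S\<in>\<S>. \<exists>g. g ` S \<subseteq> M \<and> mball x r \<subseteq> mtopology closure_of (g ` S)" if x: "x \<in> M" for x
    proof -
      obtain S where S: "S \<in> \<S>" "ld x \<le>o |S|" using loc[OF x] by blast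
      then show ?thesis using ball_dense_image[OF x S(2)] by blast
    qed
  qed
qed

text \<open>A point at which the local density is attained may have a compact neighbourhood if the local
  density is \<open>\<aleph>\<^sub>0\<close>. If the local density is countable, a point of non-local compactness is
  used instead: near it dense sets are infinite, as required. If the local
  density is uncountable, then a point that attains it has no precompact neighbourhood.\<close>

lemma realized_cof_equiv:
  assumes "local_density_realized mtopology"
  shows "cof_equiv precompacts (Fpow T \<times> Fin_seq (Field ldens))"
proof -
  have Fld: "|Field ldens| =o ldens" by (rule card_of_Field_ordIso[OF Card_order_ldens])
  have "\<exists>x\<in>M. \<forall>r>0. \<not> mtotally_bounded (X \<inter> mball x r) \<and>
          (\<forall>D. D \<subseteq> X \<inter> mball x r \<longrightarrow> X \<inter> mball x r \<subseteq> mtopology closure_of D \<longrightarrow> |Field ldens| \<le>o |D| )"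
  proof (cases "countable (Field ldens)")
    case True
    obtain x where x: "x \<in> M" "\<And>r. 0 < r \<Longrightarrow> \<not> mtotally_bounded (X \<inter> mball x r)"
      using not_precompact_point by blast
    have "|Field ldens| \<le>o |D|"
      if "0 < r" "D \<subseteq> X \<inter> mball x r" "X \<inter> mball x r \<subseteq> mtopology closure_of D" for r D
    proof -
      have "infinite D"
        using finite_dense_imp_mtotally_bounded[of D] that X(1) x(2)[OF that(1)] by blast
      then have "|UNIV :: nat set| \<le>o |D|" using infinite_iff_card_of_nat by blast
      moreover have "|Field ldens| \<le>o |UNIV :: nat set|" using True countable_card_of_nat by blast
      ultimately show ?thesis using ordLeq_transitive by blast
    qed
    then show ?thesis using x by blast
  next
    case False
    obtain x where x: "x \<in> M" "ld x =o ldens" using assms unfolding local_density_realized_def by auto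
    have le: "|Field ldens| \<le>o ld x"
      using ordIso_ordLeq_trans[OF Fld ordIso_imp_ordLeq[OF ordIso_symmetric[OF x(2)]]] .
    have "uncountable (Field (ld x))"
    proof
      assume "countable (Field (ld x))"
      moreover have "|Field ldens| \<le>o |Field (ld x)|"
        using ordLeq_ordIso_trans[OF le ordIso_symmetric[OF card_of_Field_ordIso[OF Card_order_local_density_at[OF x(1)]]]] .
      ultimately show False using False countable_ordLeq by blast
    qed
    then have "\<not> mtotally_bounded (X \<inter> mball x r)" if "0 < r" for r
      using uncountable_local_density_at[OF X x(1) that] by blast
    moreover have "|Field ldens| \<le>o |D|"
      if "0 < r" "D \<subseteq> X \<inter> mball x r" "X \<inter> mball x r \<subseteq> mtopology closure_of D" for r D
      using ordLeq_transitive[OF le local_density_at_le_card[OF X x(1) that]] .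
    ultimately show ?thesis using x(1) by blast
  qed
  then obtain x where x: "x \<in> M" "\<And>r. 0 < r \<Longrightarrow> \<not> mtotally_bounded (X \<inter> mball x r)"
      "\<And>r D. 0 < r \<Longrightarrow> D \<subseteq> X \<inter> mball x r \<Longrightarrow> X \<inter> mball x r \<subseteq> mtopology closure_of D
         \<Longrightarrow> |Field ldens| \<le>o |D|"
    by blast
  have "cof_equiv precompacts (Fpow T \<times> (\<Union>S\<in>{Field ldens}. Fin_seq S))"
  proof (rule precompacts_cof_equiv[where E = "{x}" and \<epsilon> = 1 and \<sigma> = "\<lambda>_. Field ldens"])
    show "\<exists>S\<in>{Field ldens}. ld y \<le>o |S|" if "y \<in> M" for y
      using ordLeq_ordIso_trans[OF ld_le_ldens[OF that] ordIso_symmetric[OF Fld]] by simp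
  qed (use x in \<open>auto simp: separated_by_def\<close>)
  then show ?thesis by simp
qed

lemma infinite_ldens:
  "infinite (Field ldens)"
proof -
  obtain x where x: "x \<in> M" "\<And>r. 0 < r \<Longrightarrow> \<not> mtotally_bounded (X \<inter> mball x r)"
    using not_precompact_point by blast
  show ?thesis
    using local_density_at_infinite[OF x] ld_le_ldens[OF x(1)] card_of_mono2 card_of_ordLeq_finite by blast
qed

text \<open>The rank \<open>\<rho> x\<close> of a point \<open>x\<close> is an ordinal below \<open>ldens\<close> whose initial segment has the cardinality
  of the local density at \<open>x\<close>, and \<open>Fin_seq\<close> of that segment is coded near \<open>x\<close>. The rank is unbounded
  on the space, since \<open>ldens\<close> is the supremum of the local densities. Near a given
  point \<open>y\<close> it is bounded, since the local densities there do not exceed that at \<open>y\<close>, which is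
  smaller than \<open>ldens\<close>. The points of \<open>E\<close> with countable local density are
  discarded, since these may have compact neighbourhoods.\<close>

lemma not_realized_cof_equiv:
  assumes nr: "\<not> local_density_realized mtopology"
  shows "cof_equiv precompacts (Fpow T \<times> Bdd_Fin_seq ldens)"
proof -
  let ?u = "underS ldens"
  have wo: "Well_order ldens" using Card_order_ldens unfolding card_order_on_def by blast
  then have wr: "wo_rel ldens" unfolding wo_rel_def .
  have ld_less: "ld x <o ldens" if "x \<in> M" for x
    using ld_le_ldens[OF that] nr that unfolding local_density_realized_def ordLeq_iff_ordLess_or_ordIso by auto
  have "\<exists>a\<in>Field ldens. |?u a| =o ld x" if x: "x \<in> M" for x
  proof -
    have co: "Card_order (ld x)" by (rule Card_order_local_density_at[OF x])
    then have "Well_order (ld x)" unfolding card_order_on_def by blast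
    then obtain a where a: "a \<in> Field ldens" "ld x =o Restr ldens (?u a)"
      using ordLess_iff_ordIso_Restr[OF wo] ld_less[OF x] by blast
    have "Field (Restr ldens (?u a)) = ?u a"
      using Field_Restr_ofilter[OF wo] wo_rel.underS_ofilter[OF wr] by blast
    then have "|Field (ld x)| =o |?u a|" using card_of_cong[OF a(2)] by simp
    then have "|?u a| =o ld x"
      using ordIso_transitive[OF ordIso_symmetric card_of_Field_ordIso[OF co]] by blast
    then show ?thesis using a(1) by blast
  qed
  then obtain \<rho> where \<rho>: "\<And>x. x \<in> M \<Longrightarrow> \<rho> x \<in> Field ldens" "\<And>x. x \<in> M \<Longrightarrow> |?u (\<rho> x)| =o ld x"
    by metis
  have u_mono: "?u a \<subseteq> ?u b" if "(a, b) \<in> ldens" for a b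
    using underS_incr[OF wo_rel.TRANS[OF wr] wo_rel.ANTISYM[OF wr] that] .
  have total: "(a, b) \<in> ldens \<or> (b, a) \<in> ldens" if "a \<in> Field ldens" "b \<in> Field ldens" for a b
    using wo_rel.TOTALS[OF wr] that by blast
  have unb: "unbounded_on ldens \<rho> M"
    unfolding unbounded_on_def
  proof (rule ballI, rule ccontr)
    fix b assume b: "b \<in> Field ldens" and no: "\<not> (\<exists>x\<in>M. (b, \<rho> x) \<in> ldens)"
    have "ld x \<le>o |?u b|" if x: "x \<in> M" for x
    proof -
      have "(\<rho> x, b) \<in> ldens" using total[OF b \<rho>(1)[OF x]] no x by blast
      then have "|?u (\<rho> x)| \<le>o |?u b|" by (intro card_of_mono1 u_mono)
      then show ?thesis using ordIso_ordLeq_trans[OF ordIso_symmetric[OF \<rho>(2)[OF x]]] by blast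
    qed
    then have "ldens \<le>o |?u b|" by (intro ldens_least card_of_Card_order)
    then show False using card_of_underS[OF Card_order_ldens b] not_ordLess_ordLeq by blast
  qed
  have locb: "\<exists>s>0. \<not> unbounded_on ldens \<rho> (mball y s)" if y: "y \<in> M" for y
  proof -
    obtain s where s: "0 < s" "\<And>x. x \<in> mball y s \<Longrightarrow> ld x \<le>o ld y"
      using local_density_at_upper_semicontinuous[OF y] by blast
    have False if ub: "unbounded_on ldens \<rho> (mball y s)"
    proof -
      have "ld z \<le>o ld y" if z: "z \<in> M" for z
      proof -
        obtain x where x: "x \<in> mball y s" "(\<rho> z, \<rho> x) \<in> ldens"
          using ub \<rho>(1)[OF z] unfolding unbounded_on_def by blast
        have xM: "x \<in> M" using x(1) by simp
        have "ld z \<le>o |?u (\<rho> x)|"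
          by (rule ordIso_ordLeq_trans[OF ordIso_symmetric[OF \<rho>(2)[OF z]]]) (intro card_of_mono1 u_mono x(2))
        also have "|?u (\<rho> x)| =o ld x" by (rule \<rho>(2)[OF xM])
        also have "ld x \<le>o ld y" by (rule s(2)[OF x(1)])
        finally show ?thesis .
      qed
      then have "ldens \<le>o ld y" by (intro ldens_least Card_order_local_density_at[OF y])
      then show False using ld_less[OF y] not_ordLess_ordLeq by blast
    qed
    then show ?thesis using s(1) by blast
  qed
  have ne: "Field ldens \<noteq> {}" using infinite_ldens by auto
  obtain U \<epsilon> where U: "U \<subseteq> M" "0 < \<epsilon>" "unbounded_on ldens \<rho> U"
      "\<And>y. y \<in> M \<Longrightarrow> \<not> unbounded_on ldens \<rho> (U \<inter> mball y \<epsilon>)"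
    using uniformly_locally_bounded_unbounded_set[OF complete ne unb locb] by blast
  obtain E where E: "E \<subseteq> U" "separated_by d \<epsilon> E" "unbounded_on ldens \<rho> E"
    using separated_unbounded_set[OF wo U(1,3) U(4)] U(1) by blast
  define E' where "E' = {x\<in>E. uncountable (?u (\<rho> x))}"
  have E'M: "E' \<subseteq> M" using E(1) U(1) unfolding E'_def by blast
  \<comment> \<open>Some local density is uncountable: one of them is infinite, and none of them is the largest.\<close>
  obtain z where z: "z \<in> M" "uncountable (?u (\<rho> z))"
  proof -
    obtain x where x: "x \<in> M" "\<And>r. 0 < r \<Longrightarrow> \<not> mtotally_bounded (X \<inter> mball x r)"
      using not_precompact_point by blast
    have inf: "infinite (Field (ld x))" by (rule local_density_at_infinite[OF x])
    have "\<not> ldens \<le>o ld x" using ld_less[OF x(1)] not_ordLess_ordLeq by blast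
    then obtain z where z: "z \<in> M" "\<not> ld z \<le>o ld x"
      using ldens_least[OF Card_order_local_density_at[OF x(1)]] by blast
    have "uncountable (?u (\<rho> z))"
    proof
      assume "countable (?u (\<rho> z))"
      then have "|?u (\<rho> z)| \<le>o |UNIV :: nat set|" using countable_card_of_nat by blast
      also have "|UNIV :: nat set| \<le>o |Field (ld x)|" using inf infinite_iff_card_of_nat by blast
      also have "|Field (ld x)| =o ld x" by (rule card_of_Field_ordIso[OF Card_order_local_density_at[OF x(1)]])
      finally have "|?u (\<rho> z)| \<le>o ld x" .
      then have "ld z \<le>o ld x" using ordIso_ordLeq_trans[OF ordIso_symmetric[OF \<rho>(2)[OF z(1)]]] by blast
      then show False using z(2) by blast
    qed
    then show thesis using that z(1) by blast
  qed
  have "cof_equiv precompacts (Fpow T \<times> (\<Union>S\<in>?u ` Field ldens. Fin_seq S))"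
  proof (rule precompacts_cof_equiv[where E = E' and \<epsilon> = \<epsilon> and \<sigma> = "\<lambda>x. ?u (\<rho> x)"])
    show "0 < \<epsilon>" by fact
    show "separated_by d \<epsilon> E'" using E(2) unfolding separated_by_def E'_def by blast
    show "?u ` Field ldens \<noteq> {}" using ne by blast
    show "\<exists>V\<in>?u ` Field ldens. S \<union> S' \<subseteq> V" if "S \<in> ?u ` Field ldens" "S' \<in> ?u ` Field ldens" for S S'
    proof -
      obtain a b where ab: "a \<in> Field ldens" "b \<in> Field ldens" "S = ?u a" "S' = ?u b"
        using \<open>S \<in> ?u ` Field ldens\<close> \<open>S' \<in> ?u ` Field ldens\<close> by blast
      then show ?thesis using total[OF ab(1,2)] u_mono[of a b] u_mono[of b a] by blast
    qed
    show "?u (\<rho> x) \<in> ?u ` Field ldens" if "x \<in> E'" for x using \<rho>(1) E'M that by blast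
    show "\<exists>x\<in>E'. S \<subseteq> ?u (\<rho> x)" if "S \<in> ?u ` Field ldens" for S
    proof -
      obtain a where a: "a \<in> Field ldens" "S = ?u a" using \<open>S \<in> ?u ` Field ldens\<close> by blast
      obtain b where b: "b \<in> Field ldens" "?u a \<subseteq> ?u b" "?u (\<rho> z) \<subseteq> ?u b"
        using total[OF a(1) \<rho>(1)[OF z(1)]] u_mono[of a "\<rho> z"] u_mono[of "\<rho> z" a] a(1) \<rho>(1)[OF z(1)]
        by blast
      obtain x where x: "x \<in> E" "(b, \<rho> x) \<in> ldens" using E(3) b(1) unfolding unbounded_on_def by blast
      have "?u b \<subseteq> ?u (\<rho> x)" by (rule u_mono[OF x(2)])
      moreover from this have "uncountable (?u (\<rho> x))"
        using z(2) b(3) countable_subset by (meson order_trans)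
      ultimately show ?thesis using x(1) a(2) b(2) unfolding E'_def by blast
    qed
    show "\<not> mtotally_bounded (X \<inter> mball x r)" if x: "x \<in> E'" "0 < r" for x r
    proof (rule uncountable_local_density_at[OF X _ x(2)])
      show xM: "x \<in> M" using x(1) E'M by blast
      have "|?u (\<rho> x)| =o |Field (ld x)|"
        using ordIso_transitive[OF \<rho>(2)[OF xM] ordIso_symmetric[OF card_of_Field_ordIso[OF Card_order_local_density_at[OF xM]]]] .
      then show "uncountable (Field (ld x))"
        using x(1) countable_ordLeq[OF ordIso_imp_ordLeq] unfolding E'_def by blast
    qed
    show "|?u (\<rho> x)| \<le>o |D|" if x: "x \<in> E'" "0 < r"
      and D: "D \<subseteq> X \<inter> mball x r" "X \<inter> mball x r \<subseteq> mtopology closure_of D" for x r D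
    proof -
      have xM: "x \<in> M" using x(1) E'M by blast
      show ?thesis
        using ordIso_ordLeq_trans[OF \<rho>(2)[OF xM] local_density_at_le_card[OF X xM x(2) D]] .
    qed
    show "\<exists>S\<in>?u ` Field ldens. ld x \<le>o |S|" if "x \<in> M" for x
      using \<rho>(1)[OF that] ordIso_imp_ordLeq[OF ordIso_symmetric[OF \<rho>(2)[OF that]]] by blast
  qed
  then show ?thesis unfolding Bdd_Fin_seq_def by simp
qed

end

section \<open>Passing to the completion\<close>

locale isometric_embedding = dom: Metric_space M d + cod: Metric_space N e
  for M :: "'a set" and d and N :: "'b set" and e +
  fixes \<iota> :: "'a \<Rightarrow> 'b"
  assumes maps_to: "\<iota> \<in> M \<rightarrow> N"
    and isometric: "\<And>x y. x \<in> M \<Longrightarrow> y \<in> M \<Longrightarrow> e (\<iota> x) (\<iota> y) = d x y"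
begin

lemma inj_on_M: "inj_on \<iota> M"
proof (rule inj_onI)
  fix x y assume xy: "x \<in> M" "y \<in> M" "\<iota> x = \<iota> y"
  then have "\<iota> y \<in> N" using maps_to by blast
  then have "d x y = 0" using isometric[OF xy(1,2)] xy(3) by simp
  then show "x = y" using xy by simp
qed

lemma image_in_mball_iff:
  assumes "x \<in> M" "y \<in> M" shows "\<iota> y \<in> cod.mball (\<iota> x) r \<longleftrightarrow> y \<in> dom.mball x r"
proof -
  have "\<iota> x \<in> N" "\<iota> y \<in> N" using assms maps_to by blast+
  then show ?thesis using assms isometric[OF assms] by simp
qed

lemma dense_image_iff:
  assumes "D \<subseteq> M"
  shows "\<iota> ` M \<subseteq> cod.mtopology closure_of (\<iota> ` D) \<longleftrightarrow> M \<subseteq> dom.mtopology closure_of D"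
proof -
  have "\<iota> x \<in> cod.mtopology closure_of (\<iota> ` D) \<longleftrightarrow> x \<in> dom.mtopology closure_of D" if "x \<in> M" for x
  proof -
    have "\<iota> x \<in> N" using that maps_to by blast
    moreover have "(\<exists>y\<in>\<iota> ` D. y \<in> cod.mball (\<iota> x) r) \<longleftrightarrow> (\<exists>y\<in>D. y \<in> dom.mball x r)" for r
      unfolding bex_simps using image_in_mball_iff[OF that] assms by blast
    ultimately show ?thesis
      using that unfolding cod.metric_closure_of dom.metric_closure_of by simp
  qed
  then show ?thesis by blast
qed

lemma mtotally_bounded_image_iff:
  assumes "K \<subseteq> M"
  shows "cod.mtotally_bounded (\<iota> ` K) \<longleftrightarrow> dom.mtotally_bounded K"
proof -
  have cover: "\<iota> ` K \<subseteq> (\<Union>x\<in>\<iota> ` F. cod.mball x r) \<longleftrightarrow> K \<subseteq> (\<Union>x\<in>F. dom.mball x r)" if "F \<subseteq> K" for F r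
  proof -
    have "\<iota> k \<in> (\<Union>x\<in>\<iota> ` F. cod.mball x r) \<longleftrightarrow> k \<in> (\<Union>x\<in>F. dom.mball x r)" if k: "k \<in> K" for k
      unfolding UN_iff bex_simps using image_in_mball_iff \<open>F \<subseteq> K\<close> assms k by (meson subsetD)
    then show ?thesis by blast
  qed
  have "(\<exists>F. finite F \<and> F \<subseteq> \<iota> ` K \<and> \<iota> ` K \<subseteq> (\<Union>x\<in>F. cod.mball x r)) \<longleftrightarrow>
        (\<exists>F. finite F \<and> F \<subseteq> K \<and> K \<subseteq> (\<Union>x\<in>F. dom.mball x r))" (is "?L \<longleftrightarrow> ?R") for r
  proof
    assume ?L
    then obtain F where F: "finite F" "F \<subseteq> \<iota> ` K" "\<iota> ` K \<subseteq> (\<Union>x\<in>F. cod.mball x r)" by blast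
    obtain F' where F': "F' \<subseteq> K" "finite F'" "F = \<iota> ` F'" using finite_subset_image[OF F(1,2)] by blast
    have "K \<subseteq> (\<Union>x\<in>F'. dom.mball x r)"
      using F(3) unfolding F'(3) cover[OF F'(1)] .
    then show ?R using F'(1,2) by (intro exI[of _ F'] conjI)
  next
    assume ?R
    then obtain F where F: "finite F" "F \<subseteq> K" "K \<subseteq> (\<Union>x\<in>F. dom.mball x r)" by blast
    have "\<iota> ` K \<subseteq> (\<Union>x\<in>\<iota> ` F. cod.mball x r)" using F(3) unfolding cover[OF F(2)] .
    then show ?L using F(1,2) by (intro exI[of _ "\<iota> ` F"] conjI finite_imageI image_mono)
  qed
  then show ?thesis unfolding dom.mtotally_bounded_def cod.mtotally_bounded_def by simp
qed

lemma PK_cof_equiv: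
  assumes "cof_equiv {K. K \<subseteq> \<iota> ` M \<and> cod.mtotally_bounded K} Q"
  shows "cof_equiv (PK M d) Q"
proof -
  let ?P = "{K. K \<subseteq> \<iota> ` M \<and> cod.mtotally_bounded K}"
  have PK: "PK M d = {K. K \<subseteq> M \<and> dom.mtotally_bounded K}" unfolding PK_def ..
  have to: "\<iota> ` K \<in> ?P" if "K \<in> PK M d" for K
    using that mtotally_bounded_image_iff[of K] unfolding PK by blast
  have from_ex: "\<exists>K\<in>PK M d. L = \<iota> ` K" if L: "L \<in> ?P" for L
  proof -
    obtain K where K: "K \<subseteq> M" "L = \<iota> ` K" using L subset_imageE[of L \<iota> M] by blast
    then show ?thesis using L mtotally_bounded_image_iff[OF K(1)] unfolding PK by blast
  qed
  have pre: "M \<inter> \<iota> -` (\<iota> ` K) = K" if "K \<subseteq> M" for K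
    using inj_on_M that unfolding inj_on_def by blast
  have "cof_maps_onto (PK M d) ?P"
  proof (rule cof_maps_ontoI[where \<psi> = "(`) \<iota>"])
    show "\<exists>K\<in>PK M d. L \<subseteq> \<iota> ` K" if "L \<in> ?P" for L using from_ex[OF that] by blast
  qed (use to in \<open>simp_all add: image_mono\<close>)
  moreover have "cof_maps_onto ?P (PK M d)"
  proof (rule cof_maps_ontoI[where \<psi> = "\<lambda>L. M \<inter> \<iota> -` L"])
    show "M \<inter> \<iota> -` L \<in> PK M d" if "L \<in> ?P" for L
    proof -
      obtain K where K: "K \<in> PK M d" "L = \<iota> ` K" using from_ex[OF \<open>L \<in> ?P\<close>] by blast
      then have "M \<inter> \<iota> -` L = K" using pre[of K] unfolding PK by blast
      then show ?thesis using K(1) by simp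
    qed
    show "M \<inter> \<iota> -` L \<subseteq> M \<inter> \<iota> -` L'" if "L \<subseteq> L'" for L L' using that by blast
    show "\<exists>L\<in>?P. K \<subseteq> M \<inter> \<iota> -` L" if "K \<in> PK M d" for K
    proof (rule bexI[OF _ to[OF that]])
      show "K \<subseteq> M \<inter> \<iota> -` (\<iota> ` K)" using that unfolding PK by blast
    qed
  qed
  ultimately show ?thesis
    using assms cof_maps_onto_trans[of "PK M d" ?P Q] cof_maps_onto_trans[of Q ?P "PK M d"]
    unfolding cof_equiv_def by blast
qed

lemma dense_subspace_image:
  assumes "cod.mcomplete" "\<not> locally_compact_space cod.mtopology"
    and dense: "dense_in cod.mtopology (\<iota> ` M)"
  shows "dense_subspace N e (\<iota> ` M) (Field (density_card dom.mtopology))"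
proof -
  let ?\<kappa> = "density_card dom.mtopology"
  have dense_dom: "dense_in dom.mtopology A \<longleftrightarrow> A \<subseteq> M \<and> M \<subseteq> dom.mtopology closure_of A" for A
    unfolding dense_in_def using closure_of_subset_topspace[of dom.mtopology A] by auto
  show ?thesis
  proof (unfold_locales)
    show "cod.mcomplete" "\<not> locally_compact_space cod.mtopology" by fact+
    show "\<iota> ` M \<subseteq> N" "N \<subseteq> cod.mtopology closure_of (\<iota> ` M)"
      using dense unfolding dense_in_def by auto
    obtain A where A: "dense_in dom.mtopology A" "?\<kappa> = |A|" using density_card(1) by blast
    have "\<iota> ` A \<subseteq> \<iota> ` M" "\<iota> ` M \<subseteq> cod.mtopology closure_of (\<iota> ` A)"
      using A(1) dense_image_iff[of A] unfolding dense_dom by blast+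
    moreover have "|\<iota> ` A| \<le>o |Field ?\<kappa>|" unfolding A(2) Field_card_of by (rule card_of_image)
    ultimately show "\<exists>D\<subseteq>\<iota> ` M. \<iota> ` M \<subseteq> cod.mtopology closure_of D \<and> |D| \<le>o |Field ?\<kappa>|" by blast
    show "|Field ?\<kappa>| \<le>o |D|" if D: "D \<subseteq> \<iota> ` M" "\<iota> ` M \<subseteq> cod.mtopology closure_of D" for D
    proof -
      obtain B where B: "B \<subseteq> M" "D = \<iota> ` B" using subset_imageE[OF D(1)] by blast
      then have "dense_in dom.mtopology B" using D(2) dense_image_iff[OF B(1)] unfolding dense_dom by blast
      then have "?\<kappa> \<le>o |B|" by (rule density_card(2))
      moreover have "|B| \<le>o |D|"
        using card_of_ordLeq[of B D] inj_on_subset[OF inj_on_M B(1)] B(2) by blast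
      moreover have "|Field ?\<kappa>| =o ?\<kappa>" by (rule card_of_Field_ordIso[OF Card_order_density_card])
      ultimately show ?thesis using ordIso_ordLeq_trans ordLeq_transitive by blast
    qed
  qed
qed

end

theorem theorem2p10:
  fixes M :: "'a set" and d :: "'a \<Rightarrow> 'a \<Rightarrow> real"
    and N :: "'b set" and e :: "'b \<Rightarrow> 'b \<Rightarrow> real" and \<iota> :: "'a \<Rightarrow> 'b"
  assumes "Metric_space M d"
    and "is_completion M d N e \<iota>"
    and "\<not> locally_compact_space (Metric_space.mtopology N e)"
  shows "(\<not> local_density_realized (Metric_space.mtopology N e) \<longrightarrow>
      cof_equiv (PK M d)
        (Fpow (Field (density_card (Metric_space.mtopology M d))) \<times>
         Bdd_Fin_seq (local_density (Metric_space.mtopology N e)))) \<and>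
    (local_density_realized (Metric_space.mtopology N e) \<or>
     uncountable_cofinality (local_density (Metric_space.mtopology N e)) \<longrightarrow>
      cof_equiv (PK M d)
        (Fpow (Field (density_card (Metric_space.mtopology M d))) \<times>
         Fin_seq (Field (local_density (Metric_space.mtopology N e)))))"
proof -
  have compl: "Metric_space N e" "Metric_space.mcomplete N e" "\<iota> \<in> M \<rightarrow> N"
      "\<forall>x\<in>M. \<forall>y\<in>M. e (\<iota> x) (\<iota> y) = d x y" "dense_in (Metric_space.mtopology N e) (\<iota> ` M)"
    using assms(2) unfolding is_completion_def by auto
  interpret isometric_embedding M d N e \<iota>
    unfolding isometric_embedding_def isometric_embedding_axioms_def
    using assms(1) compl by blast
  interpret sub: dense_subspace N e "\<iota> ` M" "Field (density_card dom.mtopology)"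
    by (rule dense_subspace_image[OF compl(2) assms(3) compl(5)])
  let ?T = "Field (density_card dom.mtopology)"
  let ?\<mu> = "local_density cod.mtopology"
  have realized: "cof_equiv (PK M d) (Fpow ?T \<times> Fin_seq (Field ?\<mu>))"
    if "local_density_realized cod.mtopology"
    by (rule PK_cof_equiv[OF sub.realized_cof_equiv[OF that]])
  have not_realized: "cof_equiv (PK M d) (Fpow ?T \<times> Bdd_Fin_seq ?\<mu>)"
    if "\<not> local_density_realized cod.mtopology"
    by (rule PK_cof_equiv[OF sub.not_realized_cof_equiv[OF that]])
  have "Bdd_Fin_seq ?\<mu> = Fin_seq (Field ?\<mu>)" if "uncountable_cofinality ?\<mu>"
    by (rule Bdd_Fin_seq_eq_Fin_seq[OF sub.Card_order_ldens sub.infinite_ldens that])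
  then show ?thesis using realized not_realized by metis
qed

end
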